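(* Let $\mathbb{G}$ be an exotic quantum permutation group, $S_N\subsetneq\mathbb{G}\subsetneq S_N^+$, with magic fundamental representation $u\in M_N(C(\mathbb{G}))$. Then $\mathbb{G}$ has free three-orbitals: for all $a,b,c,d,e,f\in\{1,\dots,N\}$, if $u_{ab}u_{cd}u_{ef}=0$ in $C(\mathbb{G})$, then either exactly one of the equalities $a=c$, $b=d$ holds, or exactly one of the equalities $c=e$, $d=f$ holds.
   Context: A magic unitary in a unital $\mathrm{C}^*$-algebra $\mathcal{A}$ is a matrix $v=(v_{ij})_{i,j=1}^N\in M_N(\mathcal{A})$ whose entries are projections with $\sum_{k}v_{ik}=1_{\mathcal{A}}=\sum_k v_{kj}$ for all $i,j$. $C(S_N^+)$ is the universal unital $\mathrm{C}^*$-algebra generated by the entries of an $N\times N$ magic unitary, and $S_N^+$ is the quantum permutation group. A quantum permutation group $\mathbb{G}\subseteq S_N^+$ is given by a unital $\mathrm{C}^*$-algebra $C(\mathbb{G})$ generated by the entries of an $N\times N$ magic unitary $u=(u_{ij})$ (the magic fundamental representation) and admitting a $*$-homomorphism $\Delta:C(\mathbb{G})\to C(\mathbb{G})\otimes_{\min}C(\mathbb{G})$ with $\Delta(u_{ij})=\sum_k u_{ik}\otimes u_{kj}$. $C(\mathbb{G})$ is taken in its universal version, i.e. it is the universal $\mathrm{C}^*$-completion of the $*$-algebra generated by the $u_{ij}$. The classical permutation group $S_N$ is viewed this way through $C(S_N)$ and the magic unitary $(\mathds{1}_{j\to i})_{i,j}$, $\mathds{1}_{j\to i}(\sigma)=\delta_{i,\sigma(j)}$.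 For two such objects, $\mathbb{H}\subseteq\mathbb{G}$ means that there is a (surjective) $*$-homomorphism $C(\mathbb{G})\to C(\mathbb{H})$ sending the generators of $C(\mathbb{G})$ to the corresponding generators of $C(\mathbb{H})$; it is strict ($\subsetneq$) if this map is not an isomorphism. $\mathbb{G}$ is called exotic if $S_N\subsetneq\mathbb{G}\subsetneq S_N^+$. $\mathbb{G}$ has free $m$-orbitals if a monomial $u_{i_1j_1}\cdots u_{i_mj_m}$ is zero only for trivial reasons, i.e. only if for some $1\leq n\leq m-1$ exactly one of $i_n=i_{n+1}$, $j_n=j_{n+1}$ holds. *)

theory Defs
  imports
    "HOL-Analysis.Analysis"
    "HOL-Algebra.Algebraic_Closure_Type"
    "HOL-Combinatorics.Perm"
begin

section \<open>Unital C*-algebras\<close>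

record 'a cstar = "(complex, 'a) module" +
  star :: "'a \<Rightarrow> 'a"
  cnorm :: "'a \<Rightarrow> real"

text \<open>
  C*-seminorms and C*-norms on a *-subalgebra \<open>S\<close> of \<open>A\<close>; completeness is not required.
\<close>

definition cstar_seminorm :: "'a cstar \<Rightarrow> 'a set \<Rightarrow> ('a \<Rightarrow> real) \<Rightarrow> bool" where
  "cstar_seminorm A S p \<longleftrightarrow>
     (\<forall>x\<in>S. 0 \<le> p x) \<and>
     (\<forall>x\<in>S. \<forall>y\<in>S. p (x \<oplus>\<^bsub>A\<^esub> y) \<le> p x + p y) \<and>
     (\<forall>c. \<forall>x\<in>S. p (c \<odot>\<^bsub>A\<^esub> x) = cmod c * p x) \<and>
     (\<forall>x\<in>S. \<forall>y\<in>S. p (x \<otimes>\<^bsub>A\<^esub> y) \<le> p x * p y) \<and>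
     (\<forall>x\<in>S. p (star A x \<otimes>\<^bsub>A\<^esub> x) = (p x)\<^sup>2)"

definition cstar_norm :: "'a cstar \<Rightarrow> 'a set \<Rightarrow> ('a \<Rightarrow> real) \<Rightarrow> bool" where
  "cstar_norm A S p \<longleftrightarrow> cstar_seminorm A S p \<and> (\<forall>x\<in>S. p x = 0 \<longrightarrow> x = \<zero>\<^bsub>A\<^esub>)"

locale cstar_algebra =
  ring A + module "ring_of_type_algebra :: complex ring" A
  for A :: "'a cstar" (structure) +
  assumes smult_mult_left:
      "\<lbrakk>x \<in> carrier A; y \<in> carrier A\<rbrakk> \<Longrightarrow> (c \<odot>\<^bsub>A\<^esub> x) \<otimes>\<^bsub>A\<^esub> y = c \<odot>\<^bsub>A\<^esub> (x \<otimes>\<^bsub>A\<^esub> y)"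
    and smult_mult_right:
      "\<lbrakk>x \<in> carrier A; y \<in> carrier A\<rbrakk> \<Longrightarrow> x \<otimes>\<^bsub>A\<^esub> (c \<odot>\<^bsub>A\<^esub> y) = c \<odot>\<^bsub>A\<^esub> (x \<otimes>\<^bsub>A\<^esub> y)"
    and star_closed: "x \<in> carrier A \<Longrightarrow> star A x \<in> carrier A"
    and star_star: "x \<in> carrier A \<Longrightarrow> star A (star A x) = x"
    and star_add:
      "\<lbrakk>x \<in> carrier A; y \<in> carrier A\<rbrakk> \<Longrightarrow> star A (x \<oplus>\<^bsub>A\<^esub> y) = star A x \<oplus>\<^bsub>A\<^esub> star A y"
    and star_smult: "x \<in> carrier A \<Longrightarrow> star A (c \<odot>\<^bsub>A\<^esub> x) = cnj c \<odot>\<^bsub>A\<^esub> star A x"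
    and star_mult:
      "\<lbrakk>x \<in> carrier A; y \<in> carrier A\<rbrakk> \<Longrightarrow> star A (x \<otimes>\<^bsub>A\<^esub> y) = star A y \<otimes>\<^bsub>A\<^esub> star A x"
    and cstar_norm_cnorm: "cstar_norm A (carrier A) (cnorm A)"
    and complete:
      "\<lbrakk>\<And>n. s n \<in> carrier A;
        \<And>e. 0 < e \<Longrightarrow> \<exists>M. \<forall>m\<ge>M. \<forall>n\<ge>M. cnorm A (s m \<ominus>\<^bsub>A\<^esub> s n) < e\<rbrakk> \<Longrightarrow>
       \<exists>x\<in>carrier A. (\<lambda>n. cnorm A (s n \<ominus>\<^bsub>A\<^esub> x)) \<longlonglongrightarrow> 0"

text \<open>Unital *-homomorphisms (\<^const>\<open>ring_hom\<close> preserves the unit).\<close>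

definition star_hom :: "'a cstar \<Rightarrow> 'b cstar \<Rightarrow> ('a \<Rightarrow> 'b) \<Rightarrow> bool" where
  "star_hom A B h \<longleftrightarrow>
     h \<in> ring_hom A B \<and>
     (\<forall>c. \<forall>x\<in>carrier A. h (c \<odot>\<^bsub>A\<^esub> x) = c \<odot>\<^bsub>B\<^esub> h x) \<and>
     (\<forall>x\<in>carrier A. h (star A x) = star B (h x))"

definition norm_dense :: "'a cstar \<Rightarrow> 'a set \<Rightarrow> bool" where
  "norm_dense A S \<longleftrightarrow> (\<forall>x\<in>carrier A. \<forall>e>0. \<exists>y\<in>S. cnorm A (x \<ominus>\<^bsub>A\<^esub> y) < e)"


section \<open>The minimal tensor product\<close>

text \<open>
  The elements \<open>\<Sum>i<n. t (a i) (b i)\<close>, for \<open>t a b\<close> playing the role of \<open>a \<otimes> b\<close>.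
\<close>

definition tensor_span ::
  "'a cstar \<Rightarrow> 'b cstar \<Rightarrow> 't cstar \<Rightarrow> ('a \<Rightarrow> 'b \<Rightarrow> 't) \<Rightarrow> 't set" where
  "tensor_span A B T t =
     {(\<Oplus>\<^bsub>T\<^esub>i\<in>{..<n}. t (a i) (b i)) | (n::nat) a b. a \<in> {..<n} \<rightarrow> carrier A \<and> b \<in> {..<n} \<rightarrow> carrier B}"

text \<open>
  \<open>(T, t)\<close> is the minimal C*-tensor product of \<open>A\<close> and \<open>B\<close>: the completion of the algebraic
  tensor product of \<open>A\<close> and \<open>B\<close> in its smallest C*-norm, which by Takesaki's theorem exists and
  is the spatial norm.  Here \<open>t\<close> is \<open>(a, b) \<mapsto> a \<otimes> b\<close>. That
  \<^term>\<open>tensor_span A B T t\<close> is a copy of the algebraic tensor product, i.e. that the linear map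
  from the algebraic tensor product induced by the bilinear map \<open>t\<close> is injective, is the condition
  \<open>tensor_inject\<close>: if \<open>b 0, ..., b (n - 1)\<close> are linearly independent and
  \<open>\<Sum>i<n. a i \<otimes> b i = 0\<close>, then every \<open>a i\<close> vanishes.
\<close>

locale min_tensor_product =
  A: cstar_algebra A + B: cstar_algebra B + T: cstar_algebra T
  for A :: "'a cstar" and B :: "'b cstar" and T :: "'t cstar" +
  fixes t :: "'a \<Rightarrow> 'b \<Rightarrow> 't"
  assumes tensor_closed: "\<lbrakk>a \<in> carrier A; b \<in> carrier B\<rbrakk> \<Longrightarrow> t a b \<in> carrier T"
    and tensor_add_left:
      "\<lbrakk>a \<in> carrier A; a' \<in> carrier A; b \<in> carrier B\<rbrakk> \<Longrightarrow>
       t (a \<oplus>\<^bsub>A\<^esub> a') b = t a b \<oplus>\<^bsub>T\<^esub> t a' b"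
    and tensor_add_right:
      "\<lbrakk>a \<in> carrier A; b \<in> carrier B; b' \<in> carrier B\<rbrakk> \<Longrightarrow>
       t a (b \<oplus>\<^bsub>B\<^esub> b') = t a b \<oplus>\<^bsub>T\<^esub> t a b'"
    and tensor_smult_left:
      "\<lbrakk>a \<in> carrier A; b \<in> carrier B\<rbrakk> \<Longrightarrow> t (c \<odot>\<^bsub>A\<^esub> a) b = c \<odot>\<^bsub>T\<^esub> t a b"
    and tensor_smult_right:
      "\<lbrakk>a \<in> carrier A; b \<in> carrier B\<rbrakk> \<Longrightarrow> t a (c \<odot>\<^bsub>B\<^esub> b) = c \<odot>\<^bsub>T\<^esub> t a b"
    and tensor_mult:
      "\<lbrakk>a \<in> carrier A; a' \<in> carrier A; b \<in> carrier B; b' \<in> carrier B\<rbrakk> \<Longrightarrow>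
       t a b \<otimes>\<^bsub>T\<^esub> t a' b' = t (a \<otimes>\<^bsub>A\<^esub> a') (b \<otimes>\<^bsub>B\<^esub> b')"
    and tensor_one: "t \<one>\<^bsub>A\<^esub> \<one>\<^bsub>B\<^esub> = \<one>\<^bsub>T\<^esub>"
    and tensor_star:
      "\<lbrakk>a \<in> carrier A; b \<in> carrier B\<rbrakk> \<Longrightarrow> star T (t a b) = t (star A a) (star B b)"
    and tensor_inject:
      "\<And>(n::nat) a b.
       \<lbrakk>a \<in> {..<n} \<rightarrow> carrier A; b \<in> {..<n} \<rightarrow> carrier B;
        \<And>c. (\<Oplus>\<^bsub>B\<^esub>i\<in>{..<n}. c i \<odot>\<^bsub>B\<^esub> b i) = \<zero>\<^bsub>B\<^esub> \<Longrightarrow> \<forall>i<n. c i = 0;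
        (\<Oplus>\<^bsub>T\<^esub>i\<in>{..<n}. t (a i) (b i)) = \<zero>\<^bsub>T\<^esub>\<rbrakk> \<Longrightarrow> \<forall>i<n. a i = \<zero>\<^bsub>A\<^esub>"
    and tensor_dense: "norm_dense T (tensor_span A B T t)"
    and tensor_min:
      "\<lbrakk>cstar_norm T (tensor_span A B T t) p; x \<in> tensor_span A B T t\<rbrakk> \<Longrightarrow> cnorm T x \<le> p x"


section \<open>Magic unitaries and quantum permutation groups\<close>

text \<open>The index set \<open>{1, ..., N}\<close> is rendered by an arbitrary finite type \<open>'n\<close>.\<close>

definition magic_unitary :: "'a cstar \<Rightarrow> ('n::finite \<Rightarrow> 'n \<Rightarrow> 'a) \<Rightarrow> bool" where
  "magic_unitary A u \<longleftrightarrow>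
     (\<forall>i j. u i j \<in> carrier A \<and> star A (u i j) = u i j \<and> u i j \<otimes>\<^bsub>A\<^esub> u i j = u i j) \<and>
     (\<forall>i. (\<Oplus>\<^bsub>A\<^esub>k\<in>UNIV. u i k) = \<one>\<^bsub>A\<^esub>) \<and>
     (\<forall>j. (\<Oplus>\<^bsub>A\<^esub>k\<in>UNIV. u k j) = \<one>\<^bsub>A\<^esub>)"

inductive_set star_alg_gen :: "'a cstar \<Rightarrow> 'a set \<Rightarrow> 'a set"
  for A :: "'a cstar" and E :: "'a set" where
  gen: "x \<in> E \<Longrightarrow> x \<in> star_alg_gen A E"
| one: "\<one>\<^bsub>A\<^esub> \<in> star_alg_gen A E"
| add: "\<lbrakk>x \<in> star_alg_gen A E; y \<in> star_alg_gen A E\<rbrakk> \<Longrightarrow> x \<oplus>\<^bsub>A\<^esub> y \<in> star_alg_gen A E"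
| smult: "x \<in> star_alg_gen A E \<Longrightarrow> c \<odot>\<^bsub>A\<^esub> x \<in> star_alg_gen A E"
| mult: "\<lbrakk>x \<in> star_alg_gen A E; y \<in> star_alg_gen A E\<rbrakk> \<Longrightarrow> x \<otimes>\<^bsub>A\<^esub> y \<in> star_alg_gen A E"
| star: "x \<in> star_alg_gen A E \<Longrightarrow> star A x \<in> star_alg_gen A E"

definition entries :: "('n \<Rightarrow> 'n \<Rightarrow> 'a) \<Rightarrow> 'a set" where
  "entries u = {u i j | i j. True}"

definition generated_by_magic :: "'a cstar \<Rightarrow> ('n::finite \<Rightarrow> 'n \<Rightarrow> 'a) \<Rightarrow> bool" where
  "generated_by_magic A u \<longleftrightarrow>
     cstar_algebra A \<and> magic_unitary A u \<and> norm_dense A (star_alg_gen A (entries u))"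

text \<open>
  \<open>(A, u)\<close> is \<open>C(G)\<close> with its magic fundamental representation, \<open>(T, t)\<close> is the minimal tensor
  square of \<open>A\<close>, and \<open>\<Delta>\<close> is the comultiplication.  The last condition says that \<open>C(G)\<close> is in
  its universal version: its norm restricts to the largest C*-seminorm on the *-algebra generated
  by the entries of \<open>u\<close>, so that \<open>A\<close> is the universal C*-completion of that *-algebra.
\<close>

definition quantum_permutation_group ::
  "'a cstar \<Rightarrow> ('n::finite \<Rightarrow> 'n \<Rightarrow> 'a) \<Rightarrow> 't cstar \<Rightarrow> ('a \<Rightarrow> 'a \<Rightarrow> 't) \<Rightarrow> ('a \<Rightarrow> 't) \<Rightarrow> bool" where
  "quantum_permutation_group A u T t \<Delta> \<longleftrightarrow>
     generated_by_magic A u \<and>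
     min_tensor_product A A T t \<and>
     star_hom A T \<Delta> \<and>
     (\<forall>i j. \<Delta> (u i j) = (\<Oplus>\<^bsub>T\<^esub>k\<in>UNIV. t (u i k) (u k j))) \<and>
     (\<forall>p. cstar_seminorm A (star_alg_gen A (entries u)) p \<longrightarrow>
          (\<forall>x\<in>star_alg_gen A (entries u). p x \<le> cnorm A x))"

text \<open>
  \<open>(P, v)\<close> is \<open>C(S_N^+)\<close>, the universal unital C*-algebra generated by the entries of a magic
  unitary.  HOL cannot quantify over the carrier type of the test algebra \<open>B\<close> inside a formula;
  the type \<^typ>\<open>real\<close> is no restriction, because the C*-subalgebra generated by the finitely many
  entries of \<open>w\<close> is separable, has at most the cardinality of the continuum, and hence is
  isomorphic to a C*-algebra whose carrier is a subset of the reals.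
\<close>

definition universal_magic_algebra :: "'p cstar \<Rightarrow> ('n::finite \<Rightarrow> 'n \<Rightarrow> 'p) \<Rightarrow> bool" where
  "universal_magic_algebra P v \<longleftrightarrow>
     generated_by_magic P v \<and>
     (\<forall>(B :: real cstar) w. cstar_algebra B \<and> magic_unitary B w \<longrightarrow>
        (\<exists>h. star_hom P B h \<and> (\<forall>i j. h (v i j) = w i j)))"

text \<open>
  \<open>C(S_N)\<close>, with the magic unitary whose \<open>(i, j)\<close> entry is the indicator function of
  \<open>{\<sigma>. \<sigma> j = i}\<close>.  For finite \<open>'n\<close> the type \<open>'n perm\<close> consists of all permutations of \<open>'n\<close>.
\<close>

definition sym_alg :: "('n::finite perm \<Rightarrow> complex) cstar" where
  "sym_alg =
     \<lparr>carrier = UNIV,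
      monoid.mult = (\<lambda>f g \<sigma>. f \<sigma> * g \<sigma>), one = (\<lambda>_. 1),
      zero = (\<lambda>_. 0), add = (\<lambda>f g \<sigma>. f \<sigma> + g \<sigma>),
      smult = (\<lambda>c f \<sigma>. c * f \<sigma>),
      star = (\<lambda>f \<sigma>. cnj (f \<sigma>)),
      cnorm = (\<lambda>f. SUP \<sigma>. cmod (f \<sigma>))\<rparr>"

definition sym_magic :: "'n::finite \<Rightarrow> 'n \<Rightarrow> 'n perm \<Rightarrow> complex" where
  "sym_magic i j = (\<lambda>\<sigma>. if i = Perm.apply \<sigma> j then 1 else 0)"

text \<open>
  \<open>H \<subseteq> G\<close> for \<open>H\<close> given by \<open>(B, w)\<close> and \<open>G\<close> given by \<open>(A, u)\<close>: a surjective *-homomorphism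
  \<open>C(G) \<rightarrow> C(H)\<close> matching generators.  On \<^term>\<open>carrier A\<close> there is at most one such map, as
  the \<open>u i j\<close> generate \<open>A\<close>.
\<close>

definition quotient_map ::
  "'b cstar \<Rightarrow> ('n \<Rightarrow> 'n \<Rightarrow> 'b) \<Rightarrow> 'a cstar \<Rightarrow> ('n \<Rightarrow> 'n \<Rightarrow> 'a) \<Rightarrow> ('a \<Rightarrow> 'b) \<Rightarrow> bool" where
  "quotient_map B w A u h \<longleftrightarrow>
     star_hom A B h \<and> h ` carrier A = carrier B \<and> (\<forall>i j. h (u i j) = w i j)"

definition strict_quantum_subgroup ::
  "'b cstar \<Rightarrow> ('n \<Rightarrow> 'n \<Rightarrow> 'b) \<Rightarrow> 'a cstar \<Rightarrow> ('n \<Rightarrow> 'n \<Rightarrow> 'a) \<Rightarrow> bool" where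
  "strict_quantum_subgroup B w A u \<longleftrightarrow>
     (\<exists>h. quotient_map B w A u h \<and> \<not> bij_betw h (carrier A) (carrier B))"

definition exotic ::
  "'a cstar \<Rightarrow> ('n::finite \<Rightarrow> 'n \<Rightarrow> 'a) \<Rightarrow> 'p cstar \<Rightarrow> ('n \<Rightarrow> 'n \<Rightarrow> 'p) \<Rightarrow> bool" where
  "exotic A u P v \<longleftrightarrow>
     strict_quantum_subgroup sym_alg sym_magic A u \<and> strict_quantum_subgroup A u P v"

text \<open>
  The product below is the monomial \<open>u (i 1) (j 1) \<otimes> ... \<otimes> u (i m) (j m)\<close>.
\<close>

definition free_orbitals :: "'a cstar \<Rightarrow> ('n \<Rightarrow> 'n \<Rightarrow> 'a) \<Rightarrow> nat \<Rightarrow> bool" where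
  "free_orbitals A u m \<longleftrightarrow>
     (\<forall>i j :: nat \<Rightarrow> 'n.
        foldr (\<lambda>k x. u (i k) (j k) \<otimes>\<^bsub>A\<^esub> x) [1..<Suc m] \<one>\<^bsub>A\<^esub> = \<zero>\<^bsub>A\<^esub> \<longrightarrow>
        (\<exists>n\<in>{1..<m}. (i n = i (Suc n)) \<noteq> (j n = j (Suc n))))"

end

theory Submission
  imports Defs
begin

text \<open>
  A monomial whose row and column indices have the same equality pattern is nonzero already in
  \<open>C(S_N)\<close>.  This leaves \<open>u a b u c d u a f\<close> with \<open>a \<noteq> c\<close> and \<open>b, d, f\<close> distinct, and the same
  with rows and columns exchanged.  Since \<open>S_N \<subseteq> G\<close>, slicing the comultiplication by a point of
  \<open>S_N\<close> shows that the zero set of monomials is invariant under permuting the rows and under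
  permuting the columns.  So if one such monomial vanishes, all do, and summing over \<open>f\<close> gives
  \<open>u a b u c d = u a b u c d u a b\<close>, which is self-adjoint: the entries commute.  But then
  \<open>C(G)\<close> is commutative and \<open>C(G) \<rightarrow> C(S_N)\<close> is injective, contradicting \<open>S_N \<noteq> G\<close>.

  The slicing is done in the algebraic tensor product.  That entries in one row or column are
  orthogonal, usually deduced from positivity, follows from the unit of a corner being an extreme
  point of its unit ball.
\<close>

section \<open>Linear algebra over the complex numbers in \<open>HOL-Algebra\<close> style\<close>

abbreviation complex_ring :: "complex ring" where
  "complex_ring \<equiv> ring_of_type_algebra"

text \<open>Restates the module laws over \<open>complex_ring\<close> with the arithmetic of type
  \<open>complex\<close>, so that simplification can compute with the scalars.\<close>

locale complex_module = module complex_ring M for M (structure)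
begin

lemma smult_in [simp, intro]: "x \<in> carrier M \<Longrightarrow> c \<odot> x \<in> carrier M"
  using smult_closed by (simp add: ring_of_type_algebra_def)

lemma smult_add_left: "x \<in> carrier M \<Longrightarrow> (c + d) \<odot> x = c \<odot> x \<oplus> d \<odot> x"
  using smult_l_distr[of c d x] by (simp add: ring_of_type_algebra_def)

lemma smult_add_right:
  "\<lbrakk>x \<in> carrier M; y \<in> carrier M\<rbrakk> \<Longrightarrow> c \<odot> (x \<oplus> y) = c \<odot> x \<oplus> c \<odot> y"
  using smult_r_distr[of c x y] by (simp add: ring_of_type_algebra_def)

lemma smult_smult [simp]: "x \<in> carrier M \<Longrightarrow> c \<odot> (d \<odot> x) = (c * d) \<odot> x"
  using smult_assoc1[of c d x] by (simp add: ring_of_type_algebra_def)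

lemma smult_1 [simp]: "x \<in> carrier M \<Longrightarrow> 1 \<odot> x = x"
  using smult_one[of x] by (simp add: ring_of_type_algebra_def)

lemma smult_0 [simp]: "x \<in> carrier M \<Longrightarrow> 0 \<odot> x = \<zero>"
  using smult_l_null[of x] by (simp add: ring_of_type_algebra_def)

lemma smult_zero [simp]: "c \<odot> \<zero> = \<zero>"
  using smult_r_null[of c] by (simp add: ring_of_type_algebra_def)

lemma a_inv_eq_smult: "x \<in> carrier M \<Longrightarrow> \<ominus> x = (- 1) \<odot> x"
  by (metis M.add.inv_equality ab_left_minus smult_0 smult_1 smult_add_left smult_in)

lemma minus_eq_smult:
  "\<lbrakk>x \<in> carrier M; y \<in> carrier M\<rbrakk> \<Longrightarrow> x \<ominus> y = x \<oplus> (- 1) \<odot> y"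
  by (simp add: a_minus_def a_inv_eq_smult)

lemma smult_eq_zero_iff: "x \<in> carrier M \<Longrightarrow> c \<odot> x = \<zero> \<longleftrightarrow> c = 0 \<or> x = \<zero>"
  by (metis left_inverse smult_0 smult_1 smult_smult smult_zero)

lemma smult_finsum:
  "\<lbrakk>finite I; f \<in> I \<rightarrow> carrier M\<rbrakk> \<Longrightarrow> c \<odot> (\<Oplus>i\<in>I. f i) = (\<Oplus>i\<in>I. c \<odot> f i)"
  using finsum_smult_ldistr[of I c f] by (simp add: ring_of_type_algebra_def)

end

sublocale cstar_algebra \<subseteq> complex_module A
  by unfold_locales

lemma finsum_hom:
  assumes "abelian_group M" "abelian_group M'"
    and "\<And>x. x \<in> carrier M \<Longrightarrow> h x \<in> carrier M'"
    and "\<And>x y. \<lbrakk>x \<in> carrier M; y \<in> carrier M\<rbrakk> \<Longrightarrow> h (x \<oplus>\<^bsub>M\<^esub> y) = h x \<oplus>\<^bsub>M'\<^esub> h y"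
    and "finite I" "f \<in> I \<rightarrow> carrier M"
  shows "h (\<Oplus>\<^bsub>M\<^esub>i\<in>I. f i) = (\<Oplus>\<^bsub>M'\<^esub>i\<in>I. h (f i))"
proof -
  interpret M: abelian_group M by fact
  interpret M': abelian_group M' by fact
  have "h \<zero>\<^bsub>M\<^esub> \<oplus>\<^bsub>M'\<^esub> h \<zero>\<^bsub>M\<^esub> = h \<zero>\<^bsub>M\<^esub>"
    using assms(4)[of "\<zero>\<^bsub>M\<^esub>" "\<zero>\<^bsub>M\<^esub>"] by simp
  then have zero: "h \<zero>\<^bsub>M\<^esub> = \<zero>\<^bsub>M'\<^esub>"
    using assms(3) M'.add.r_cancel_one' by (metis M.zero_closed)
  show ?thesis
    using assms(5,6)
  proof (induction I)
    case (insert i I)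
    then have "f i \<in> carrier M" "f \<in> I \<rightarrow> carrier M" "(\<lambda>i. h (f i)) \<in> I \<rightarrow> carrier M'"
      using assms(3) by auto
    with insert show ?case
      using assms(3,4) by simp
  qed (simp add: zero)
qed

section \<open>Bilinear maps and the algebraic tensor product\<close>

locale complex_bilinear =
  A: complex_module A + B: complex_module B + C: complex_module C
  for A :: "(complex, 'a, 'k) module_scheme" and B :: "(complex, 'b, 'l) module_scheme"
    and C :: "(complex, 'c, 'm) module_scheme" +
  fixes \<beta> :: "'a \<Rightarrow> 'b \<Rightarrow> 'c"
  assumes closed: "\<lbrakk>a \<in> carrier A; b \<in> carrier B\<rbrakk> \<Longrightarrow> \<beta> a b \<in> carrier C"
    and add_left: "\<lbrakk>a \<in> carrier A; a' \<in> carrier A; b \<in> carrier B\<rbrakk> \<Longrightarrow>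
      \<beta> (a \<oplus>\<^bsub>A\<^esub> a') b = \<beta> a b \<oplus>\<^bsub>C\<^esub> \<beta> a' b"
    and add_right: "\<lbrakk>a \<in> carrier A; b \<in> carrier B; b' \<in> carrier B\<rbrakk> \<Longrightarrow>
      \<beta> a (b \<oplus>\<^bsub>B\<^esub> b') = \<beta> a b \<oplus>\<^bsub>C\<^esub> \<beta> a b'"
    and smult_left: "\<lbrakk>a \<in> carrier A; b \<in> carrier B\<rbrakk> \<Longrightarrow> \<beta> (c \<odot>\<^bsub>A\<^esub> a) b = c \<odot>\<^bsub>C\<^esub> \<beta> a b"
    and smult_right: "\<lbrakk>a \<in> carrier A; b \<in> carrier B\<rbrakk> \<Longrightarrow> \<beta> a (c \<odot>\<^bsub>B\<^esub> b) = c \<odot>\<^bsub>C\<^esub> \<beta> a b"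
begin

text \<open>Expanding \<open>b k\<close> and moving each \<open>d i\<close> into the first argument
  spreads the \<open>k\<close>-th summand over the others. The new coefficients do not depend on
  \<open>\<beta>\<close>, so the same reduction serves \<open>t\<close> and any other bilinear map
  at once.\<close>

lemma finsum_eliminate:
  assumes "finite I" "k \<in> I" "a \<in> I \<rightarrow> carrier A" "b \<in> I \<rightarrow> carrier B"
    and bk: "b k = (\<Oplus>\<^bsub>B\<^esub>i\<in>I - {k}. d i \<odot>\<^bsub>B\<^esub> b i)"
  shows "(\<Oplus>\<^bsub>C\<^esub>i\<in>I. \<beta> (a i) (b i)) = (\<Oplus>\<^bsub>C\<^esub>i\<in>I - {k}. \<beta> (a i \<oplus>\<^bsub>A\<^esub> d i \<odot>\<^bsub>A\<^esub> a k) (b i))"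
proof -
  have mem: "a i \<in> carrier A" "b i \<in> carrier B" if "i \<in> I" for i
    using that assms(3,4) by auto
  have "\<beta> (a k) (b k) = (\<Oplus>\<^bsub>C\<^esub>i\<in>I - {k}. \<beta> (a k) (d i \<odot>\<^bsub>B\<^esub> b i))"
    unfolding bk
    by (rule finsum_hom) (use mem assms(1,2) closed add_right in \<open>auto intro: B.abelian_group_axioms C.abelian_group_axioms\<close>)
  also have "\<dots> = (\<Oplus>\<^bsub>C\<^esub>i\<in>I - {k}. \<beta> (d i \<odot>\<^bsub>A\<^esub> a k) (b i))"
    by (rule C.M.finsum_cong') (use mem assms(2) closed in \<open>auto simp: smult_left smult_right\<close>)
  finally have k: "\<beta> (a k) (b k) = \<dots>" .
  have "I = insert k (I - {k})"
    using assms(2) by auto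
  then have "(\<Oplus>\<^bsub>C\<^esub>i\<in>I. \<beta> (a i) (b i)) = (\<Oplus>\<^bsub>C\<^esub>i\<in>insert k (I - {k}). \<beta> (a i) (b i))"
    by simp
  also have "\<dots> = \<beta> (a k) (b k) \<oplus>\<^bsub>C\<^esub> (\<Oplus>\<^bsub>C\<^esub>i\<in>I - {k}. \<beta> (a i) (b i))"
    by (rule C.M.finsum_insert) (use mem assms(1,2) closed in auto)
  also have "\<dots> = (\<Oplus>\<^bsub>C\<^esub>i\<in>I - {k}. \<beta> (a i) (b i)) \<oplus>\<^bsub>C\<^esub> \<beta> (a k) (b k)"
    by (rule C.M.a_comm) (use mem assms(1,2) closed in auto)
  also have "\<dots> = (\<Oplus>\<^bsub>C\<^esub>i\<in>I - {k}. \<beta> (a i) (b i) \<oplus>\<^bsub>C\<^esub> \<beta> (d i \<odot>\<^bsub>A\<^esub> a k) (b i))"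
    unfolding k by (rule C.M.finsum_addf[symmetric]) (use mem assms(2) closed in auto)
  also have "\<dots> = (\<Oplus>\<^bsub>C\<^esub>i\<in>I - {k}. \<beta> (a i \<oplus>\<^bsub>A\<^esub> d i \<odot>\<^bsub>A\<^esub> a k) (b i))"
    by (rule C.M.finsum_cong') (use mem assms(2) closed in \<open>auto simp: add_left\<close>)
  finally show ?thesis .
qed

end

context min_tensor_product
begin

lemma complex_bilinear_tensor: "complex_bilinear A B T t"
  by unfold_locales
    (auto simp: tensor_closed tensor_add_left tensor_add_right tensor_smult_left tensor_smult_right)

text \<open>An enumeration \<open>e\<close> of \<open>I\<close> carries \<open>tensor_inject\<close>
  over to arbitrary finite index sets, which arise when indices are deleted one by one and when
  summing over triples of indices.\<close>

lemma tensor_inject_finite: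
  assumes "finite I" "a \<in> I \<rightarrow> carrier A" "b \<in> I \<rightarrow> carrier B"
    and indep: "\<And>c. (\<Oplus>\<^bsub>B\<^esub>i\<in>I. c i \<odot>\<^bsub>B\<^esub> b i) = \<zero>\<^bsub>B\<^esub> \<Longrightarrow> \<forall>i\<in>I. c i = 0"
    and zero: "(\<Oplus>\<^bsub>T\<^esub>i\<in>I. t (a i) (b i)) = \<zero>\<^bsub>T\<^esub>"
    and "i \<in> I"
  shows "a i = \<zero>\<^bsub>A\<^esub>"
proof -
  obtain e where e: "bij_betw e {..<card I} I"
    using ex_bij_betw_nat_finite[OF \<open>finite I\<close>] by (auto simp: atLeast0LessThan)
  then have inj: "inj_on e {..<card I}" and img: "e ` {..<card I} = I"
    by (auto simp: bij_betw_def)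
  have mem: "a i \<in> carrier A" "b i \<in> carrier B" if "i \<in> I" for i
    using that assms(2,3) by auto
  have e_in: "e n \<in> I" if "n < card I" for n
    using that img by blast
  have "\<forall>n<card I. a (e n) = \<zero>\<^bsub>A\<^esub>"
  proof (rule tensor_inject[where b = "\<lambda>n. b (e n)"])
    show "(\<lambda>n. a (e n)) \<in> {..<card I} \<rightarrow> carrier A" "(\<lambda>n. b (e n)) \<in> {..<card I} \<rightarrow> carrier B"
      using mem img by auto
    have "(\<Oplus>\<^bsub>T\<^esub>i\<in>e ` {..<card I}. t (a i) (b i)) = (\<Oplus>\<^bsub>T\<^esub>n\<in>{..<card I}. t (a (e n)) (b (e n)))"
      by (rule T.finsum_reindex) (use mem img inj in \<open>auto intro!: tensor_closed\<close>)
    then show "(\<Oplus>\<^bsub>T\<^esub>n\<in>{..<card I}. t (a (e n)) (b (e n))) = \<zero>\<^bsub>T\<^esub>"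
      using zero img by simp
  next
    fix c :: "nat \<Rightarrow> complex"
    define c' where "c' = (\<lambda>i. c (the_inv_into {..<card I} e i))"
    have c': "c' (e n) = c n" if "n < card I" for n
      using that inj by (simp add: c'_def the_inv_into_f_f)
    assume "(\<Oplus>\<^bsub>B\<^esub>n\<in>{..<card I}. c n \<odot>\<^bsub>B\<^esub> b (e n)) = \<zero>\<^bsub>B\<^esub>"
    moreover have "(\<Oplus>\<^bsub>B\<^esub>i\<in>e ` {..<card I}. c' i \<odot>\<^bsub>B\<^esub> b i) =
        (\<Oplus>\<^bsub>B\<^esub>n\<in>{..<card I}. c' (e n) \<odot>\<^bsub>B\<^esub> b (e n))"
      by (rule B.finsum_reindex) (use mem img inj in auto)
    moreover have "\<dots> = (\<Oplus>\<^bsub>B\<^esub>n\<in>{..<card I}. c n \<odot>\<^bsub>B\<^esub> b (e n))"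
      by (rule B.finsum_cong') (use mem e_in in \<open>auto simp: c'\<close>)
    ultimately have "\<forall>i\<in>I. c' i = 0"
      using indep[of c'] img by simp
    then show "\<forall>n<card I. c n = 0"
      using c' img by (metis imageI lessThan_iff)
  qed
  then show ?thesis
    using \<open>i \<in> I\<close> img by (metis imageE lessThan_iff)
qed

text \<open>
  Every bilinear map factors through the algebraic tensor product inside \<open>T\<close>: a linear dependence
  among the \<open>b i\<close> removes one summand from both sums, and if there is none, all \<open>a i\<close> vanish.
\<close>

lemma bilinear_sum_eq_zero:
  assumes "complex_bilinear A B C \<beta>"
    and "finite I" "a \<in> I \<rightarrow> carrier A" "b \<in> I \<rightarrow> carrier B"
    and "(\<Oplus>\<^bsub>T\<^esub>i\<in>I. t (a i) (b i)) = \<zero>\<^bsub>T\<^esub>"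
  shows "(\<Oplus>\<^bsub>C\<^esub>i\<in>I. \<beta> (a i) (b i)) = \<zero>\<^bsub>C\<^esub>"
  using assms(2-)
proof (induction "card I" arbitrary: I a)
  case 0
  interpret \<beta>: complex_bilinear A B C \<beta> by fact
  from 0 show ?case by simp
next
  case (Suc n)
  interpret \<beta>: complex_bilinear A B C \<beta> by fact
  interpret t: complex_bilinear A B T t by (rule complex_bilinear_tensor)
  have mem: "a i \<in> carrier A" "b i \<in> carrier B" if "i \<in> I" for i
    using that Suc.prems by auto
  show ?case
  proof (cases "\<forall>c. (\<Oplus>\<^bsub>B\<^esub>i\<in>I. c i \<odot>\<^bsub>B\<^esub> b i) = \<zero>\<^bsub>B\<^esub> \<longrightarrow> (\<forall>i\<in>I. c i = 0)")
    case True
    then have "a i = \<zero>\<^bsub>A\<^esub>" if "i \<in> I" for i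
      using tensor_inject_finite[OF Suc.prems(1-3) _ Suc.prems(4) that] by blast
    moreover have "\<beta> \<zero>\<^bsub>A\<^esub> (b i) = \<zero>\<^bsub>C\<^esub>" if "i \<in> I" for i
      using \<beta>.smult_left[of "\<zero>\<^bsub>A\<^esub>" "b i" 0] mem that
      by (simp add: \<beta>.closed)
    ultimately show ?thesis
      by (intro \<beta>.C.M.add.finprod_one_eqI) simp
  next
    case False
    then obtain c k where c: "(\<Oplus>\<^bsub>B\<^esub>i\<in>I. c i \<odot>\<^bsub>B\<^esub> b i) = \<zero>\<^bsub>B\<^esub>" "k \<in> I" "c k \<noteq> 0"
      by auto
    \<comment> \<open>The linear dependence solved for \<open>b k\<close>.\<close>
    define d where "d = (\<lambda>i. - (c i / c k))"
    let ?S = "\<Oplus>\<^bsub>B\<^esub>i\<in>I - {k}. c i \<odot>\<^bsub>B\<^esub> b i"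
    have S: "?S \<in> carrier B"
      by (rule B.finsum_closed) (use mem in auto)
    have "I = insert k (I - {k})"
      using c(2) by auto
    then have "(\<Oplus>\<^bsub>B\<^esub>i\<in>insert k (I - {k}). c i \<odot>\<^bsub>B\<^esub> b i) = \<zero>\<^bsub>B\<^esub>"
      using c(1) by simp
    moreover have "(\<Oplus>\<^bsub>B\<^esub>i\<in>insert k (I - {k}). c i \<odot>\<^bsub>B\<^esub> b i) = c k \<odot>\<^bsub>B\<^esub> b k \<oplus>\<^bsub>B\<^esub> ?S"
      by (rule B.finsum_insert) (use mem Suc.prems(1) c(2) in auto)
    ultimately have "c k \<odot>\<^bsub>B\<^esub> b k = (- 1) \<odot>\<^bsub>B\<^esub> ?S"
      using B.minus_equality[of "c k \<odot>\<^bsub>B\<^esub> b k" ?S] B.a_inv_eq_smult[OF S] S mem[OF c(2)] by simp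
    then have "(1 / c k) \<odot>\<^bsub>B\<^esub> (c k \<odot>\<^bsub>B\<^esub> b k) = (1 / c k) \<odot>\<^bsub>B\<^esub> ((- 1) \<odot>\<^bsub>B\<^esub> ?S)"
      by simp
    then have "b k = (- 1 / c k) \<odot>\<^bsub>B\<^esub> ?S"
      using c mem S by simp
    also have "\<dots> = (\<Oplus>\<^bsub>B\<^esub>i\<in>I - {k}. (- 1 / c k) \<odot>\<^bsub>B\<^esub> (c i \<odot>\<^bsub>B\<^esub> b i))"
      by (rule B.smult_finsum) (use mem Suc.prems(1) in auto)
    also have "\<dots> = (\<Oplus>\<^bsub>B\<^esub>i\<in>I - {k}. d i \<odot>\<^bsub>B\<^esub> b i)"
      by (rule B.finsum_cong') (use mem in \<open>auto simp: d_def\<close>)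
    finally have bk: "b k = \<dots>" .
    have "(\<Oplus>\<^bsub>C\<^esub>i\<in>I - {k}. \<beta> (a i \<oplus>\<^bsub>A\<^esub> d i \<odot>\<^bsub>A\<^esub> a k) (b i)) = \<zero>\<^bsub>C\<^esub>"
    proof (rule Suc.hyps(1))
      show "n = card (I - {k})" "finite (I - {k})" "b \<in> I - {k} \<rightarrow> carrier B"
        "(\<lambda>i. a i \<oplus>\<^bsub>A\<^esub> d i \<odot>\<^bsub>A\<^esub> a k) \<in> I - {k} \<rightarrow> carrier A"
        using Suc.hyps(2) Suc.prems(1) c(2) mem by auto
      show "(\<Oplus>\<^bsub>T\<^esub>i\<in>I - {k}. t (a i \<oplus>\<^bsub>A\<^esub> d i \<odot>\<^bsub>A\<^esub> a k) (b i)) = \<zero>\<^bsub>T\<^esub>"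
        using t.finsum_eliminate[OF Suc.prems(1) c(2) Suc.prems(2,3) bk] Suc.prems(4) by simp
    qed
    then show ?thesis
      using \<beta>.finsum_eliminate[OF Suc.prems(1) c(2) Suc.prems(2,3) bk] by simp
  qed
qed

end

section \<open>Projections summing to the unit\<close>

lemma ring_imp_semiring:
  assumes "ring R"
  shows "semiring R"
proof -
  interpret ring R by fact
  show ?thesis by (rule semiring_axioms)
qed

context cstar_algebra
begin

text \<open>Inside this locale the unqualified ring laws are those of the scalars; restate those of \<open>A\<close>.\<close>

lemma semiring_A: "semiring A"
  using cstar_algebra_axioms ring_imp_semiring by (auto simp: cstar_algebra_def)

lemma abelian_A: "abelian_group A" "abelian_monoid A"
  using cstar_algebra_axioms by (auto simp: cstar_algebra_def ring_def abelian_group_def)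

lemmas a_assoc = semiring.semiring_simprules(5)[OF semiring_A]
  and a_ac = semiring.semiring_simprules(5,7,12)[OF semiring_A]
  and finsum_closed = abelian_monoid.finsum_closed[OF abelian_A(2)]
  and finsum_insert = abelian_monoid.finsum_insert[OF abelian_A(2)]
  and minus_equality = abelian_group.minus_equality[OF abelian_A(1)]
  and r_neg1 = abelian_group.r_neg1[OF abelian_A(1)]
  and l_neg = abelian_group.l_neg[OF abelian_A(1)]
  and m_assoc = semiring.semiring_simprules(8)[OF semiring_A]
  and l_distr = semiring.semiring_simprules(10)[OF semiring_A]
  and r_distr = semiring.semiring_simprules(13)[OF semiring_A]
  and finsum_ldistr = semiring.finsum_ldistr[OF semiring_A]
  and finsum_rdistr = semiring.finsum_rdistr[OF semiring_A]

lemma finsum_eq_zero: "(\<And>i. i \<in> I \<Longrightarrow> f i = \<zero>) \<Longrightarrow> (\<Oplus>i\<in>I. f i) = \<zero>"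
  using comm_monoid.finprod_one_eqI[OF abelian_monoid.a_comm_monoid[OF abelian_A(2)], of I f]
  by (simp add: finsum_def)

lemma finsum_single:
  assumes "finite I" "i \<in> I" "f i \<in> carrier A" "\<And>j. j \<in> I \<Longrightarrow> j \<noteq> i \<Longrightarrow> f j = \<zero>"
  shows "(\<Oplus>j\<in>I. f j) = f i"
proof -
  have "(\<Oplus>j\<in>insert i (I - {i}). f j) = f i \<oplus> (\<Oplus>j\<in>I - {i}. f j)"
    by (rule finsum_insert) (use assms in auto)
  moreover have "(\<Oplus>j\<in>I - {i}. f j) = \<zero>"
    by (rule finsum_eq_zero) (use assms(4) in auto)
  ultimately show ?thesis
    using assms(2,3) by (simp add: insert_absorb)
qed

lemma a_swap:
  "\<lbrakk>w \<in> carrier A; x \<in> carrier A; y \<in> carrier A; z \<in> carrier A\<rbrakk> \<Longrightarrow>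
    (w \<oplus> x) \<oplus> (y \<oplus> z) = (w \<oplus> y) \<oplus> (x \<oplus> z)"
  by (simp add: a_ac)

section \<open>The C*-norm and extremality of the unit of a corner\<close>

lemma cnorm_nonneg: "x \<in> carrier A \<Longrightarrow> 0 \<le> cnorm A x"
  and cnorm_triangle:
    "\<lbrakk>x \<in> carrier A; y \<in> carrier A\<rbrakk> \<Longrightarrow> cnorm A (x \<oplus> y) \<le> cnorm A x + cnorm A y"
  and cnorm_smult: "x \<in> carrier A \<Longrightarrow> cnorm A (c \<odot> x) = cmod c * cnorm A x"
  and cnorm_mult:
    "\<lbrakk>x \<in> carrier A; y \<in> carrier A\<rbrakk> \<Longrightarrow> cnorm A (x \<otimes> y) \<le> cnorm A x * cnorm A y"
  and cnorm_star_mult: "x \<in> carrier A \<Longrightarrow> cnorm A (star A x \<otimes> x) = (cnorm A x)\<^sup>2"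
  and cnorm_zeroD: "\<lbrakk>x \<in> carrier A; cnorm A x = 0\<rbrakk> \<Longrightarrow> x = \<zero>"
  using cstar_norm_cnorm by (auto simp: cstar_norm_def cstar_seminorm_def)

lemma cnorm_zero [simp]: "cnorm A \<zero> = 0"
  using cnorm_smult[of \<zero> 0] by simp

lemma cnorm_mult_le_1:
  assumes "x \<in> carrier A" "y \<in> carrier A" "cnorm A x \<le> 1"
  shows "cnorm A (x \<otimes> y) \<le> cnorm A y"
  using cnorm_mult[OF assms(1,2)] mult_right_mono[OF assms(3) cnorm_nonneg[OF assms(2)]] by simp

lemma star_mult_eq_zero_iff:
  assumes "x \<in> carrier A"
  shows "star A x \<otimes> x = \<zero> \<longleftrightarrow> x = \<zero>"
  using cnorm_star_mult[OF assms] cnorm_zeroD[OF assms] assms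
  by (auto simp: star_closed)

text \<open>
  The unit of a corner is an extreme point of its unit ball.  Convexity applied to
  \<open>2 (\<alpha> p + (m + 1) s) = (p - s) ((\<alpha> - 1) p + m s) + (p + s) ((\<alpha> + 1) p + m s)\<close>
  yields \<open>\<parallel>\<alpha> p + m s\<parallel> \<le> (\<alpha>\<^sup>2 + m + r\<^sup>2) / (2 r)\<close> by induction on \<open>m\<close>; now take \<open>\<alpha> = 0\<close>,
  \<open>m = r\<^sup>2\<close> and let \<open>r\<close> tend to infinity.
\<close>

lemma corner_unit_extreme:
  assumes p: "p \<in> carrier A" "p \<otimes> p = p"
    and s: "s \<in> carrier A" "p \<otimes> s = s" "s \<otimes> p = s"
    and plus: "cnorm A (p \<oplus> s) \<le> 1" and minus: "cnorm A (p \<oplus> (- 1) \<odot> s) \<le> 1"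
  shows "s = \<zero>"
proof -
  define e where "e \<alpha> \<mu> = \<alpha> \<odot> p \<oplus> \<mu> \<odot> s" for \<alpha> \<mu>
  \<comment> \<open>A product of two elements \<open>e\<close> also produces a multiple of
    \<open>s \<otimes> s\<close>, which \<open>q\<close> keeps apart.\<close>
  define q where "q \<mu> = \<mu> \<odot> (s \<otimes> s)" for \<mu>
  have e [simp]: "e \<alpha> \<mu> \<in> carrier A" and q [simp]: "q \<mu> \<in> carrier A" for \<alpha> \<mu>
    by (simp_all add: e_def q_def p s)
  have e_add: "e \<alpha> \<mu> \<oplus> e \<alpha>' \<mu>' = e (\<alpha> + \<alpha>') (\<mu> + \<mu>')" for \<alpha> \<mu> \<alpha>' \<mu>'
    using p(1) s(1) by (simp add: e_def smult_add_left a_ac)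
  have q_add: "q \<mu> \<oplus> q \<mu>' = q (\<mu> + \<mu>')" for \<mu> \<mu>'
    using s(1) by (simp add: q_def smult_add_left)
  have e_mult: "e 1 \<epsilon> \<otimes> e \<alpha> \<mu> = e \<alpha> (\<mu> + \<epsilon> * \<alpha>) \<oplus> q (\<epsilon> * \<mu>)" for \<epsilon> \<alpha> \<mu>
    using p s by (simp add: e_def q_def l_distr r_distr smult_mult_left smult_mult_right
        smult_add_left smult_add_right a_ac mult.commute)
  have e_smult: "c \<odot> e \<alpha> \<mu> = e (c * \<alpha>) (c * \<mu>)" for c \<alpha> \<mu>
    using p(1) s(1) by (simp add: e_def smult_add_right)
  have norm_e: "cnorm A (e 1 1) \<le> 1" "cnorm A (e 1 (- 1)) \<le> 1"
    using plus minus p s by (simp_all add: e_def)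
  have norm_p: "cnorm A p \<le> 1"
  proof -
    have "2 \<odot> p = e 1 1 \<oplus> e 1 (- 1)"
      using p s by (subst e_add) (simp add: e_def)
    then have "2 * cnorm A p \<le> cnorm A (e 1 1) + cnorm A (e 1 (- 1))"
      using cnorm_smult[OF p(1), of 2] cnorm_triangle[of "e 1 1" "e 1 (- 1)"] by simp
    then show ?thesis
      using norm_e by simp
  qed
  have bound: "cnorm A (e (of_real \<alpha>) (of_nat m)) \<le> (\<alpha>\<^sup>2 + m + r\<^sup>2) / (2 * r)"
    if "0 < r" for \<alpha> r :: real and m :: nat
  proof (induction m arbitrary: \<alpha>)
    case 0
    have "cnorm A (e (of_real \<alpha>) 0) = \<bar>\<alpha>\<bar> * cnorm A p"
      using p(1) s(1) cnorm_smult[OF p(1), of "of_real \<alpha>"] by (simp add: e_def)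
    also have "\<dots> \<le> \<bar>\<alpha>\<bar>"
      using norm_p mult_left_mono[OF norm_p, of "\<bar>\<alpha>\<bar>"] by simp
    also have "\<dots> \<le> (\<alpha>\<^sup>2 + r\<^sup>2) / (2 * r)"
      using that sum_squares_bound[of "\<bar>\<alpha>\<bar>" r] by (simp add: field_simps)
    finally show ?case
      by simp
  next
    case (Suc m)
    let ?a = "complex_of_real \<alpha>" and ?m = "of_nat m :: complex"
    \<comment> \<open>The two multiples of \<open>s \<otimes> s\<close> have opposite signs and
      cancel.\<close>
    have "e 1 (- 1) \<otimes> e (?a - 1) ?m \<oplus> e 1 1 \<otimes> e (?a + 1) ?m =
        (e (?a - 1) (?m + (- 1) * (?a - 1)) \<oplus> e (?a + 1) (?m + 1 * (?a + 1))) \<oplus>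
        (q (- 1 * ?m) \<oplus> q (1 * ?m))"
      unfolding e_mult by (rule a_swap) simp_all
    also have "\<dots> = 2 \<odot> e ?a (?m + 1)"
      using s(1) by (simp add: e_add q_add e_smult algebra_simps) (simp add: q_def)
    finally have "2 * cnorm A (e ?a (?m + 1)) =
        cnorm A (e 1 (- 1) \<otimes> e (?a - 1) ?m \<oplus> e 1 1 \<otimes> e (?a + 1) ?m)"
      by (simp add: cnorm_smult)
    also have "\<dots> \<le> cnorm A (e (of_real (\<alpha> - 1)) ?m) + cnorm A (e (of_real (\<alpha> + 1)) ?m)"
      using cnorm_triangle[of "e 1 (- 1) \<otimes> e (?a - 1) ?m" "e 1 1 \<otimes> e (?a + 1) ?m"]
        cnorm_mult_le_1[OF _ _ norm_e(1), of "e (?a + 1) ?m"]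
        cnorm_mult_le_1[OF _ _ norm_e(2), of "e (?a - 1) ?m"] by simp
    also have "\<dots> \<le> ((\<alpha> - 1)\<^sup>2 + m + r\<^sup>2) / (2 * r) + ((\<alpha> + 1)\<^sup>2 + m + r\<^sup>2) / (2 * r)"
      using Suc[of "\<alpha> - 1"] Suc[of "\<alpha> + 1"] by simp
    \<comment> \<open>The squares of \<open>\<alpha> - 1\<close> and \<open>\<alpha> + 1\<close> add
      up to \<open>2 * \<alpha>\<^sup>2 + 2\<close>; the extra \<open>2\<close> turns
      \<open>m\<close> into \<open>Suc m\<close>.\<close>
    also have "\<dots> = 2 * ((\<alpha>\<^sup>2 + Suc m + r\<^sup>2) / (2 * r))"
      using that by (simp add: field_simps power2_eq_square)
    finally have "cnorm A (e ?a (?m + 1)) \<le> (\<alpha>\<^sup>2 + Suc m + r\<^sup>2) / (2 * r)"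
      by (rule mult_left_le_imp_le) simp
    then show ?case
      by (simp add: add.commute)
  qed
  have "cnorm A s \<le> inverse (Suc n)" for n
  proof -
    let ?r = "real (Suc n)"
    have "?r\<^sup>2 * cnorm A s = cnorm A (e (of_real 0) (of_nat ((Suc n)\<^sup>2)))"
      using p(1) s(1) by (simp add: e_def cnorm_smult norm_power del: of_nat_Suc of_nat_power)
    also have "\<dots> \<le> (0\<^sup>2 + real ((Suc n)\<^sup>2) + ?r\<^sup>2) / (2 * ?r)"
      by (rule bound) simp
    also have "\<dots> = ?r"
      unfolding of_nat_power by (simp add: power2_eq_square del: of_nat_Suc)
    finally have "?r * (?r * cnorm A s) \<le> ?r * 1"
      by (simp add: power2_eq_square mult.assoc del: of_nat_Suc)
    then have "?r * cnorm A s \<le> 1"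
      by (subst (asm) mult_le_cancel_left_pos) simp_all
    then show ?thesis
      by (simp add: field_simps del: of_nat_Suc)
  qed
  then have "cnorm A s \<le> 0"
    by (intro LIMSEQ_le_const[OF LIMSEQ_inverse_real_of_nat]) blast
  then show ?thesis
    using cnorm_zeroD[OF s(1)] cnorm_nonneg[OF s(1)] by simp
qed

text \<open>Let \<open>n\<close> be the number of indices other than \<open>j\<close> and
  \<open>s = a j / (n + 1)\<close>. Since the other \<open>a k\<close> sum to \<open>- a j\<close>,
  \<open>(n + 1) (p + s)\<close> is \<open>p\<close> plus the \<open>n\<close> differences
  \<open>p - a k\<close>, while \<open>(n + 1) (p - s)\<close> is \<open>n p + (p - a j)\<close>.
  Both are sums of \<open>n + 1\<close> elements of norm at most one, so \<open>p + s\<close> and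
  \<open>p - s\<close> lie in the unit ball and extremality of \<open>p\<close> gives
  \<open>s = 0\<close>.\<close>

lemma corner_sum_zero:
  assumes p: "p \<in> carrier A" "p \<otimes> p = p" "cnorm A p \<le> 1"
    and K: "finite K" "j \<in> K"
    and a: "\<And>k. k \<in> K \<Longrightarrow> a k \<in> carrier A" "\<And>k. k \<in> K \<Longrightarrow> p \<otimes> a k = a k"
      "\<And>k. k \<in> K \<Longrightarrow> a k \<otimes> p = a k" "\<And>k. k \<in> K \<Longrightarrow> cnorm A (p \<ominus> a k) \<le> 1"
    and sum: "(\<Oplus>k\<in>K. a k) = \<zero>"
  shows "a j = \<zero>"
proof -
  \<comment> \<open>The element is the sum of the \<open>card L\<close> differences
    \<open>p - a k\<close>, each of norm at most one.\<close>
  have bound: "cnorm A (of_nat (card L) \<odot> p \<ominus> (\<Oplus>k\<in>L. a k)) \<le> card L" if "L \<subseteq> K" for L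
    using finite_subset[OF that K(1)] that
  proof (induction L)
    case empty
    then show ?case
      using p(1) by (simp add: a_minus_def)
  next
    case (insert k L)
    have ak: "a k \<in> carrier A" and S: "(\<Oplus>k\<in>L. a k) \<in> carrier A"
      by (use insert.prems a(1) in \<open>auto intro!: finsum_closed\<close>)
    have "of_nat (card (insert k L)) \<odot> p \<ominus> (\<Oplus>k\<in>insert k L. a k) =
        (p \<ominus> a k) \<oplus> (of_nat (card L) \<odot> p \<ominus> (\<Oplus>k\<in>L. a k))"
    proof -
      have "(\<Oplus>k\<in>insert k L. a k) = a k \<oplus> (\<Oplus>k\<in>L. a k)"
        by (rule finsum_insert) (use insert a(1) in auto)
      then show ?thesis
        using insert.hyps p(1) ak S
        by (simp add: minus_eq_smult smult_add_left smult_add_right a_ac)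
    qed
    then have "cnorm A (of_nat (card (insert k L)) \<odot> p \<ominus> (\<Oplus>k\<in>insert k L. a k)) \<le>
        cnorm A (p \<ominus> a k) + cnorm A (of_nat (card L) \<odot> p \<ominus> (\<Oplus>k\<in>L. a k))"
      using cnorm_triangle[of "p \<ominus> a k" "of_nat (card L) \<odot> p \<ominus> (\<Oplus>k\<in>L. a k)"] p(1) ak S
      by simp
    also have "\<dots> \<le> 1 + card L"
      using insert a(4)[of k] by auto
    finally show ?case
      using insert.hyps by simp
  qed
  define n where "n = card (K - {j})"
  define s where "s = (1 / of_nat (Suc n)) \<odot> a j"
  note aj = a(1-3)[OF K(2)]
  have s: "s \<in> carrier A" "p \<otimes> s = s" "s \<otimes> p = s"
    using p aj by (simp_all add: s_def smult_mult_left smult_mult_right)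
  let ?S = "\<Oplus>k\<in>K - {j}. a k"
  have S: "?S \<in> carrier A"
    by (rule finsum_closed) (use a(1) in auto)
  have "(\<Oplus>k\<in>insert j (K - {j}). a k) = a j \<oplus> ?S"
    by (rule finsum_insert) (use a(1) K in auto)
  then have "a j \<oplus> ?S = \<zero>"
    using sum K(2) by (simp add: insert_absorb)
  then have S_eq: "\<ominus> ?S = a j"
    using aj(1) S minus_equality by blast
  have nz: "complex_of_nat (Suc n) \<noteq> 0"
    by (rule of_nat_neq_0)
  have "s = \<zero>"
  proof (rule corner_unit_extreme[OF p(1,2) s])
    have "of_nat (Suc n) \<odot> (p \<oplus> s) = p \<oplus> (of_nat n \<odot> p \<ominus> ?S)"
      using p(1) aj(1) nz unfolding a_minus_def S_eq s_def
      by (simp add: smult_add_right smult_add_left a_ac)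
    then have "Suc n * cnorm A (p \<oplus> s) = cnorm A (p \<oplus> (of_nat n \<odot> p \<ominus> ?S))"
      using cnorm_smult[of "p \<oplus> s" "of_nat (Suc n)"] p(1) s(1) by (simp del: of_nat_Suc)
    also have "\<dots> \<le> 1 + n"
      using cnorm_triangle[of p "of_nat n \<odot> p \<ominus> ?S"] bound[of "K - {j}"] p S
      by (simp add: n_def)
    finally have "real (Suc n) * cnorm A (p \<oplus> s) \<le> real (Suc n) * 1"
      by simp
    then show "cnorm A (p \<oplus> s) \<le> 1"
      by (subst (asm) mult_le_cancel_left_pos) simp_all
    have "of_nat (Suc n) \<odot> (p \<oplus> (- 1) \<odot> s) = of_nat n \<odot> p \<oplus> (p \<ominus> a j)"
      using p(1) aj(1) nz unfolding s_def
      by (simp add: smult_add_right smult_add_left minus_eq_smult a_ac)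
    then have "Suc n * cnorm A (p \<oplus> (- 1) \<odot> s) = cnorm A (of_nat n \<odot> p \<oplus> (p \<ominus> a j))"
      using cnorm_smult[of "p \<oplus> (- 1) \<odot> s" "of_nat (Suc n)"] p(1) s(1) by (simp del: of_nat_Suc)
    also have "\<dots> \<le> cnorm A (of_nat n \<odot> p) + 1"
      using cnorm_triangle[of "of_nat n \<odot> p" "p \<ominus> a j"] a(4)[OF K(2)] p(1) aj(1) by simp
    also have "\<dots> \<le> n + 1"
      using mult_left_mono[OF p(3), of n] p(1) by (simp add: cnorm_smult)
    finally have "real (Suc n) * cnorm A (p \<oplus> (- 1) \<odot> s) \<le> real (Suc n) * 1"
      by simp
    then show "cnorm A (p \<oplus> (- 1) \<odot> s) \<le> 1"
      by (subst (asm) mult_le_cancel_left_pos) simp_all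
  qed
  then show ?thesis
    using smult_eq_zero_iff[OF aj(1)] nz by (simp add: s_def)
qed

section \<open>Orthogonality of projections with sum one\<close>

definition projection :: "'a \<Rightarrow> bool" where
  "projection p \<longleftrightarrow> p \<in> carrier A \<and> star A p = p \<and> p \<otimes> p = p"

text \<open>By the C*-identity the norm of \<open>p\<close> equals its own square, so it is zero or
  one.\<close>

lemma projection_norm_le_1:
  assumes "projection p"
  shows "cnorm A p \<le> 1"
proof -
  have "cnorm A p * cnorm A p = cnorm A p"
    using cnorm_star_mult[of p] assms by (simp add: projection_def power2_eq_square)
  then show ?thesis
    by auto
qed

lemma star_one: "star A \<one> = \<one>"
  using star_mult[of "star A \<one>" \<one>] star_star[of \<one>] star_closed[of \<one>] by simp

lemma projection_complement:
  assumes "projection p"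
  shows "projection (\<one> \<ominus> p)"
proof -
  have p: "p \<in> carrier A" "star A p = p" "p \<otimes> p = p"
    using assms by (simp_all add: projection_def)
  moreover have "(- 1) \<odot> p \<oplus> p = \<zero>"
    using l_neg[OF p(1)] by (simp add: a_inv_eq_smult p(1))
  ultimately show ?thesis
    unfolding projection_def
    by (simp add: minus_eq_smult star_add star_smult star_one l_distr r_distr smult_mult_left
        smult_mult_right smult_add_right a_assoc)
qed

text \<open>Compressing the sum to the corner of \<open>P i\<close> shows that the elements
  \<open>P i \<otimes> P k \<otimes> P i\<close> with \<open>k \<noteq> i\<close> sum to zero. By
  \<open>corner_sum_zero\<close> each of them vanishes, and the one for \<open>k = j\<close> is
  \<open>star A y \<otimes> y\<close> with \<open>y = P j \<otimes> P i\<close>.\<close>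

lemma projections_orthogonal:
  assumes I: "finite I" "i \<in> I" "j \<in> I" "i \<noteq> j"
    and P: "\<And>k. k \<in> I \<Longrightarrow> projection (P k)"
    and sum: "(\<Oplus>k\<in>I. P k) = \<one>"
  shows "P j \<otimes> P i = \<zero>"
proof -
  have Pk: "P k \<in> carrier A" "star A (P k) = P k" "P k \<otimes> P k = P k" if "k \<in> I" for k
    using P[OF that] by (simp_all add: projection_def)
  note p = Pk[OF I(2)]
  define a where "a k = P i \<otimes> P k \<otimes> P i" for k
  have a: "a k \<in> carrier A" if "k \<in> I" for k
    using that I(2) Pk by (simp add: a_def)
  have "(\<Oplus>k\<in>I. a k) = P i \<otimes> (\<Oplus>k\<in>I. P k) \<otimes> P i"
    using I(1) p Pk unfolding a_def
    by (subst finsum_rdistr) (auto simp: finsum_ldistr)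
  also have "\<dots> = P i"
    using sum p by simp
  finally have "(\<Oplus>k\<in>I. a k) = P i" .
  moreover have "(\<Oplus>k\<in>insert i (I - {i}). a k) = a i \<oplus> (\<Oplus>k\<in>I - {i}. a k)"
    by (rule finsum_insert) (use I a in auto)
  ultimately have "P i \<oplus> (\<Oplus>k\<in>I - {i}. a k) = P i"
    using I(2) p by (simp add: insert_absorb a_def)
  moreover have S: "(\<Oplus>k\<in>I - {i}. a k) \<in> carrier A"
    by (rule finsum_closed) (use a in auto)
  ultimately have sum0: "(\<Oplus>k\<in>I - {i}. a k) = \<zero>"
    using p(1) r_neg1 l_neg by metis
  have "a j = \<zero>"
  proof (rule corner_sum_zero[OF p(1,3) projection_norm_le_1[OF P[OF I(2)]] _ _ _ _ _ _ sum0])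
    show "finite (I - {i})" "j \<in> I - {i}"
      using I by auto
    fix k assume "k \<in> I - {i}"
    then have k: "k \<in> I" by simp
    show "a k \<in> carrier A"
      using a k by simp
    show "P i \<otimes> a k = a k"
      using p Pk[OF k] by (simp add: a_def m_assoc[symmetric])
    show "a k \<otimes> P i = a k"
      using p Pk[OF k] by (simp add: a_def m_assoc)
    note c = projection_complement[OF P[OF k]]
    \<comment> \<open>\<open>P i - a k\<close> equals \<open>star A x \<otimes> x\<close>, and
      \<open>x\<close> is a product of two projections, so the norm is at most one.\<close>
    define x where "x = (\<one> \<ominus> P k) \<otimes> P i"
    have x: "x \<in> carrier A"
      using p Pk[OF k] by (simp add: x_def)
    have "star A (\<one> \<ominus> P k) = \<one> \<ominus> P k"
      using c by (simp add: projection_def)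
    then have "star A x \<otimes> x = P i \<otimes> ((\<one> \<ominus> P k) \<otimes> (\<one> \<ominus> P k)) \<otimes> P i"
      using p Pk(1)[OF k] by (simp add: x_def star_mult m_assoc)
    also have "\<dots> = P i \<otimes> (\<one> \<ominus> P k) \<otimes> P i"
      using c by (simp add: projection_def)
    also have "\<dots> = P i \<ominus> a k"
      using p Pk[OF k] by (simp add: a_def minus_eq_smult l_distr r_distr smult_mult_left smult_mult_right)
    finally have "cnorm A (P i \<ominus> a k) = (cnorm A x)\<^sup>2"
      using cnorm_star_mult[OF x] by simp
    moreover have "cnorm A x \<le> 1"
      using cnorm_mult_le_1[of "\<one> \<ominus> P k" "P i"] projection_norm_le_1[OF c]
        projection_norm_le_1[OF P[OF I(2)]] p Pk[OF k] by (simp add: x_def)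
    ultimately show "cnorm A (P i \<ominus> a k) \<le> 1"
      using cnorm_nonneg[OF x] by (simp add: power_le_one)
  qed
  moreover have "star A (P j \<otimes> P i) \<otimes> (P j \<otimes> P i) = P i \<otimes> (P j \<otimes> P j) \<otimes> P i"
    using p Pk(1,2)[OF I(3)] by (simp add: star_mult m_assoc)
  then have "star A (P j \<otimes> P i) \<otimes> (P j \<otimes> P i) = a j"
    using Pk(3)[OF I(3)] by (simp add: a_def)
  ultimately show ?thesis
    using star_mult_eq_zero_iff[of "P j \<otimes> P i"] p Pk[OF I(3)] by simp
qed

text \<open>The line spanned by a nonzero \<open>q\<close> is closed. If \<open>y n\<close> tends to
  \<open>x\<close> and acts on \<open>q\<close> as the scalar \<open>c n\<close>, then the
  \<open>c n\<close> form a Cauchy sequence and \<open>x\<close> acts as their limit.\<close>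

lemma closure_acts_as_scalar:
  assumes S: "norm_dense A S" "\<And>y. y \<in> S \<Longrightarrow> y \<in> carrier A"
    and q: "q \<in> carrier A" "q \<noteq> \<zero>"
    and scalar: "\<And>y. y \<in> S \<Longrightarrow> \<exists>c. y \<otimes> q = c \<odot> q"
    and x: "x \<in> carrier A"
  shows "\<exists>c. x \<otimes> q = c \<odot> q"
proof -
  have "\<exists>y\<in>S. cnorm A (x \<ominus> y) < inverse (Suc n)" for n
    using S(1) x by (simp add: norm_dense_def)
  then obtain y where y: "\<And>n. y n \<in> S" "\<And>n. cnorm A (x \<ominus> y n) < inverse (Suc n)"
    by metis
  then have "\<forall>n. \<exists>c. y n \<otimes> q = c \<odot> q"
    using scalar by blast
  from choice[OF this] obtain c where c: "\<And>n. y n \<otimes> q = c n \<odot> q"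
    by blast
  have yc: "y n \<in> carrier A" for n
    using S(2) y(1) by blast
  have norm_q: "0 < cnorm A q"
    using cnorm_nonneg[OF q(1)] cnorm_zeroD[OF q(1)] q(2) by (auto simp: less_le)
  have approx: "cnorm A (x \<otimes> q \<ominus> c n \<odot> q) \<le> inverse (Suc n) * cnorm A q" for n
  proof -
    have "x \<otimes> q \<ominus> c n \<odot> q = (x \<ominus> y n) \<otimes> q"
      using x q(1) yc[of n] c[of n] by (simp add: minus_eq_smult l_distr smult_mult_left)
    then have "cnorm A (x \<otimes> q \<ominus> c n \<odot> q) \<le> cnorm A (x \<ominus> y n) * cnorm A q"
      using cnorm_mult[of "x \<ominus> y n" q] x q(1) yc[of n] by simp
    also have "\<dots> \<le> inverse (Suc n) * cnorm A q"
      using y(2)[of n] norm_q by (intro mult_right_mono) auto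
    finally show ?thesis .
  qed
  have split: "(a \<ominus> b) \<oplus> (b \<ominus> d) = a \<ominus> d" if "a \<in> carrier A" "b \<in> carrier A" "d \<in> carrier A" for a b d
  proof -
    have "(a \<ominus> b) \<oplus> (b \<ominus> d) = (a \<ominus> d) \<oplus> ((- 1) \<odot> b \<oplus> b)"
      using that by (simp add: minus_eq_smult a_ac)
    also have "(- 1) \<odot> b \<oplus> b = \<zero>"
      using l_neg[OF that(2)] that(2) by (simp add: a_inv_eq_smult)
    finally show ?thesis
      using that by simp
  qed
  have norm_minus: "cnorm A (a \<ominus> b) = cnorm A (b \<ominus> a)" if "a \<in> carrier A" "b \<in> carrier A" for a b
  proof -
    have "a \<ominus> b = (- 1) \<odot> (b \<ominus> a)"
      using that by (simp add: minus_eq_smult smult_add_right a_ac)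
    then show ?thesis
      using that cnorm_smult[of "b \<ominus> a" "- 1"] by simp
  qed
  have diff: "cmod (a - b) * cnorm A q = cnorm A (a \<odot> q \<ominus> b \<odot> q)" for a b
    using cnorm_smult[OF q(1), of "a - b"] smult_add_left[OF q(1), of a "- b"] q(1)
    by (simp add: minus_eq_smult)
  \<comment> \<open>Both multiples of \<open>q\<close> are compared with
    \<open>x \<otimes> q\<close>, and the positive norm of \<open>q\<close> is cancelled.\<close>
  have cauchy: "cmod (c m - c n) \<le> inverse (Suc m) + inverse (Suc n)" for m n
  proof -
    have "cmod (c m - c n) * cnorm A q \<le>
        cnorm A (c m \<odot> q \<ominus> x \<otimes> q) + cnorm A (x \<otimes> q \<ominus> c n \<odot> q)"
      unfolding diff
      using cnorm_triangle[of "c m \<odot> q \<ominus> x \<otimes> q" "x \<otimes> q \<ominus> c n \<odot> q"] x q(1)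
        split[of "c m \<odot> q" "x \<otimes> q" "c n \<odot> q"] by simp
    also have "\<dots> \<le> (inverse (Suc m) + inverse (Suc n)) * cnorm A q"
      using approx[of m] approx[of n] norm_minus[of "c m \<odot> q" "x \<otimes> q"] x q(1)
      by (simp add: distrib_right)
    finally show ?thesis
      using norm_q by (simp add: mult_le_cancel_right)
  qed
  have "Cauchy c"
  proof (rule metric_CauchyI)
    fix e :: real assume "0 < e"
    then obtain M where M: "inverse (Suc M) < e / 2"
      using reals_Archimedean[of "e / 2"] by auto
    have "dist (c m) (c n) < e" if "M \<le> m" "M \<le> n" for m n
    proof -
      have "inverse (real (Suc k)) \<le> inverse (real (Suc M))" if "M \<le> k" for k
        using that by (intro le_imp_inverse_le) auto
      from this[OF that(1)] this[OF that(2)] show ?thesis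
        using cauchy[of m n] M unfolding dist_norm by linarith
    qed
    then show "\<exists>M. \<forall>m\<ge>M. \<forall>n\<ge>M. dist (c m) (c n) < e"
      by blast
  qed
  then obtain d where d: "c \<longlonglongrightarrow> d"
    using Cauchy_convergent_iff convergent_def by blast
  have "cnorm A (x \<otimes> q \<ominus> d \<odot> q) \<le> (inverse (Suc n) + cmod (c n - d)) * cnorm A q" for n
    using cnorm_triangle[of "x \<otimes> q \<ominus> c n \<odot> q" "c n \<odot> q \<ominus> d \<odot> q"] x q(1)
      split[of "x \<otimes> q" "c n \<odot> q" "d \<odot> q"] approx[of n] diff[of "c n" d]
    by (simp add: distrib_right)
  moreover have "(\<lambda>n. (inverse (Suc n) + cmod (c n - d)) * cnorm A q) \<longlonglongrightarrow> (0 + cmod (d - d)) * cnorm A q"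
    by (intro tendsto_intros LIMSEQ_inverse_real_of_nat d)
  ultimately have "cnorm A (x \<otimes> q \<ominus> d \<odot> q) \<le> (0 + cmod (d - d)) * cnorm A q"
    by (intro LIMSEQ_le_const) auto
  then have "cnorm A (x \<otimes> q \<ominus> d \<odot> q) = 0"
    using cnorm_nonneg[of "x \<otimes> q \<ominus> d \<odot> q"] x q(1) by simp
  then have zero: "x \<otimes> q \<ominus> d \<odot> q = \<zero>"
    using cnorm_zeroD[of "x \<otimes> q \<ominus> d \<odot> q"] x q(1) by simp
  have "x \<otimes> q = (x \<otimes> q \<ominus> d \<odot> q) \<oplus> (d \<odot> q \<ominus> \<zero>)"
    using split[of "x \<otimes> q" "d \<odot> q" \<zero>] x q(1) by (simp add: minus_eq_smult)
  then show ?thesis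
    using zero q(1) by (auto simp: minus_eq_smult)
qed

end

section \<open>Magic unitaries\<close>

locale magic = cstar_algebra A for A :: "'a cstar" (structure) +
  fixes u :: "'n::finite \<Rightarrow> 'n \<Rightarrow> 'a"
  assumes magic_unitary: "magic_unitary A u"
begin

lemma u_closed [simp]: "u i j \<in> carrier A"
  and u_star [simp]: "star A (u i j) = u i j"
  and u_idem [simp]: "u i j \<otimes> u i j = u i j"
  and row_sum: "(\<Oplus>k\<in>UNIV. u i k) = \<one>"
  and col_sum: "(\<Oplus>k\<in>UNIV. u k j) = \<one>"
  using magic_unitary by (auto simp: magic_unitary_def)

lemma row_orthogonal: "j \<noteq> k \<Longrightarrow> u i j \<otimes> u i k = \<zero>"
  by (rule projections_orthogonal[of UNIV k j "u i"]) (auto simp: projection_def row_sum)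

lemma col_orthogonal: "i \<noteq> k \<Longrightarrow> u i j \<otimes> u k j = \<zero>"
  by (rule projections_orthogonal[of UNIV k i "\<lambda>i. u i j"]) (auto simp: projection_def col_sum)

lemma gen_closed: "x \<in> star_alg_gen A (entries u) \<Longrightarrow> x \<in> carrier A"
  by (induction rule: star_alg_gen.induct) (auto simp: entries_def star_closed)

lemma mult_col_sum:
  assumes "x \<in> carrier A"
  shows "(\<Oplus>k\<in>UNIV. x \<otimes> u k j) = x"
  using finsum_rdistr[of UNIV x "\<lambda>k. u k j"] assms by (simp add: col_sum)

lemma mult_row_sum:
  assumes "x \<in> carrier A"
  shows "(\<Oplus>k\<in>UNIV. x \<otimes> u i k) = x"
  using finsum_rdistr[of UNIV x "u i"] assms by (simp add: row_sum)

text \<open>The product of three factors is self-adjoint, hence so is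
  \<open>u a b \<otimes> u c d\<close>; a product of two self-adjoint elements is self-adjoint
  exactly when they commute.\<close>

lemma commute_if_absorbed:
  assumes "u a b \<otimes> u c d \<otimes> u a b = u a b \<otimes> u c d"
  shows "u a b \<otimes> u c d = u c d \<otimes> u a b"
proof -
  have "star A (u a b \<otimes> u c d \<otimes> u a b) = u a b \<otimes> u c d \<otimes> u a b"
    by (simp add: star_mult m_assoc)
  then have "star A (u a b \<otimes> u c d) = u a b \<otimes> u c d"
    using assms by simp
  then show ?thesis
    by (simp add: star_mult)
qed

end

section \<open>Evaluation at classical permutations\<close>

lemma sym_alg_simps [simp]:
  "carrier sym_alg = UNIV" "f \<otimes>\<^bsub>sym_alg\<^esub> g = (\<lambda>\<tau>. f \<tau> * g \<tau>)" "\<one>\<^bsub>sym_alg\<^esub> = (\<lambda>_. 1)"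
  "\<zero>\<^bsub>sym_alg\<^esub> = (\<lambda>_. 0)" "f \<oplus>\<^bsub>sym_alg\<^esub> g = (\<lambda>\<tau>. f \<tau> + g \<tau>)"
  "c \<odot>\<^bsub>sym_alg\<^esub> f = (\<lambda>\<tau>. c * f \<tau>)" "star sym_alg f = (\<lambda>\<tau>. cnj (f \<tau>))"
  by (simp_all add: sym_alg_def)

text \<open>\<open>h\<close> plays the role of the map from C(G) to C(S_N). For fixed
  \<open>\<tau>\<close>, the map \<open>\<lambda>x. h x \<tau>\<close> is a character of
  \<open>A\<close>: the point \<open>\<tau>\<close> of S_N inside G.\<close>

locale classical_point = magic A u
  for A :: "'a cstar" (structure) and u :: "'n::finite \<Rightarrow> 'n \<Rightarrow> 'a" +
  fixes h :: "'a \<Rightarrow> 'n perm \<Rightarrow> complex"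
  assumes hom: "star_hom A sym_alg h"
    and h_u: "h (u i j) = sym_magic i j"
begin

lemma h_add: "\<lbrakk>x \<in> carrier A; y \<in> carrier A\<rbrakk> \<Longrightarrow> h (x \<oplus> y) \<tau> = h x \<tau> + h y \<tau>"
  and h_mult: "\<lbrakk>x \<in> carrier A; y \<in> carrier A\<rbrakk> \<Longrightarrow> h (x \<otimes> y) \<tau> = h x \<tau> * h y \<tau>"
  and h_one: "h \<one> \<tau> = 1"
  and h_smult: "x \<in> carrier A \<Longrightarrow> h (c \<odot> x) \<tau> = c * h x \<tau>"
  using hom by (auto simp: star_hom_def ring_hom_def)

lemma h_zero: "h \<zero> \<tau> = 0"
  using h_smult[of \<zero> 0 \<tau>] by simp

lemma h_entry: "h (u i j) \<tau> = (if i = Perm.apply \<tau> j then 1 else 0)"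
  by (simp add: h_u sym_magic_def)

text \<open>
  If the entries commute, a nonzero \<open>x\<close> stays nonzero when multiplied by a suitable product \<open>q\<close>
  of entries, one from each column.  These entries describe a permutation \<open>\<tau>\<close>, and every
  polynomial in the entries acts on \<open>q\<close> as a scalar; by density so does \<open>x\<close>, and the scalar is
  \<open>h x \<tau>\<close>.
\<close>

lemma ex_column_product:
  assumes comm: "\<And>i j k l. u i j \<otimes> u k l = u k l \<otimes> u i j"
    and x: "x \<in> carrier A" "x \<noteq> \<zero>" and "finite J"
  shows "\<exists>q f. q \<in> carrier A \<and> x \<otimes> q \<noteq> \<zero> \<and> (\<forall>j\<in>J. u (f j) j \<otimes> q = q) \<and>
    (\<forall>\<tau>. (\<forall>j\<in>J. Perm.apply \<tau> j = f j) \<longrightarrow> h q \<tau> = 1)"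
  using \<open>finite J\<close>
proof (induction J)
  case empty
  show ?case
    using x by (intro exI[of _ \<one>]) (simp add: h_one)
next
  case (insert j J)
  then obtain q f where q: "q \<in> carrier A" "x \<otimes> q \<noteq> \<zero>" "\<forall>j\<in>J. u (f j) j \<otimes> q = q"
    "\<forall>\<tau>. (\<forall>j\<in>J. Perm.apply \<tau> j = f j) \<longrightarrow> h q \<tau> = 1"
    by blast
  \<comment> \<open>Column \<open>j\<close> sums to one, so these products add up to
    \<open>x \<otimes> q\<close>, and at least one of them is nonzero.\<close>
  have "(\<Oplus>i\<in>UNIV. x \<otimes> u i j \<otimes> q) = (\<Oplus>i\<in>UNIV. x \<otimes> u i j) \<otimes> q"
    using x(1) q(1) by (subst finsum_ldistr) auto
  also have "\<dots> \<noteq> \<zero>"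
    using q(2) mult_col_sum[OF x(1)] by simp
  finally have "\<exists>i. x \<otimes> u i j \<otimes> q \<noteq> \<zero>"
    by (rule contrapos_np) (rule finsum_eq_zero, simp)
  then obtain i where i: "x \<otimes> u i j \<otimes> q \<noteq> \<zero>"
    by blast
  show ?case
  proof (intro exI conjI ballI allI impI)
    show "u i j \<otimes> q \<in> carrier A"
      using q(1) by simp
    show "x \<otimes> (u i j \<otimes> q) \<noteq> \<zero>"
      using i x(1) q(1) by (simp add: m_assoc)
    show "u ((f(j := i)) k) k \<otimes> (u i j \<otimes> q) = u i j \<otimes> q" if "k \<in> insert j J" for k
    proof (cases "k = j")
      case True
      then show ?thesis
        using q(1) by (simp add: m_assoc[symmetric])
    next
      case False
      then have "u (f k) k \<otimes> q = q"
        using q(3) that by simp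
      moreover have "u (f k) k \<otimes> (u i j \<otimes> q) = u i j \<otimes> (u (f k) k \<otimes> q)"
        using q(1) comm[of "f k" k i j] by (simp add: m_assoc[symmetric])
      ultimately show ?thesis
        using False by simp
    qed
    show "h (u i j \<otimes> q) \<tau> = 1" if "\<forall>k\<in>insert j J. Perm.apply \<tau> k = (f(j := i)) k" for \<tau>
    proof -
      have "Perm.apply \<tau> k = f k" if "k \<in> J" for k
        using that insert.hyps(2) \<open>\<forall>k\<in>insert j J. Perm.apply \<tau> k = (f(j := i)) k\<close> by auto
      then have "h q \<tau> = 1"
        using q(4) by blast
      then show ?thesis
        using that q(1) by (simp add: h_mult h_entry)
    qed
  qed
qed

text \<open>Each entry acts on \<open>q\<close> as one or zero, because \<open>q\<close> absorbs
  \<open>u (f j) j\<close> and the other entries of column \<open>j\<close> are orthogonal to it.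
  The adjoint is carried along so that the case \<open>star\<close> only exchanges the two
  scalars.\<close>

lemma gen_acts_as_scalar:
  assumes q: "q \<in> carrier A" and f: "\<And>j. u (f j) j \<otimes> q = q"
    and y: "y \<in> star_alg_gen A (entries u)"
  shows "\<exists>c c'. y \<otimes> q = c \<odot> q \<and> star A y \<otimes> q = c' \<odot> q"
  using y
proof (induction rule: star_alg_gen.induct)
  case (gen y)
  then obtain i j where y: "y = u i j"
    by (auto simp: entries_def)
  have "u i j \<otimes> q = u i j \<otimes> u (f j) j \<otimes> q"
    using q f by (simp add: m_assoc)
  also have "\<dots> = (if i = f j then 1 else 0) \<odot> q"
    using q f col_orthogonal[of i "f j" j] semiring.l_null[OF semiring_A q] by auto
  finally have "u i j \<otimes> q = (if i = f j then 1 else 0) \<odot> q" .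
  then show ?case
    unfolding y u_star by blast
next
  case one
  show ?case
    using q by (intro exI[of _ 1]) (simp add: star_one)
next
  case (add x y)
  then obtain c c' d d' where "x \<otimes> q = c \<odot> q" "star A x \<otimes> q = c' \<odot> q"
    "y \<otimes> q = d \<odot> q" "star A y \<otimes> q = d' \<odot> q"
    by blast
  then have "(x \<oplus> y) \<otimes> q = (c + d) \<odot> q" "star A (x \<oplus> y) \<otimes> q = (c' + d') \<odot> q"
    using q add(1,2)[THEN gen_closed]
    by (simp_all add: l_distr star_add star_closed smult_add_left)
  then show ?case
    by blast
next
  case (smult x d)
  then obtain c c' where "x \<otimes> q = c \<odot> q" "star A x \<otimes> q = c' \<odot> q"
    by blast
  then have "(d \<odot> x) \<otimes> q = (d * c) \<odot> q" "star A (d \<odot> x) \<otimes> q = (cnj d * c') \<odot> q"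
    using q smult(1)[THEN gen_closed]
    by (simp_all add: smult_mult_left star_smult star_closed)
  then show ?case
    by blast
next
  case (mult x y)
  then obtain c c' d d' where "x \<otimes> q = c \<odot> q" "star A x \<otimes> q = c' \<odot> q"
    "y \<otimes> q = d \<odot> q" "star A y \<otimes> q = d' \<odot> q"
    by blast
  then have "(x \<otimes> y) \<otimes> q = (d * c) \<odot> q" "star A (x \<otimes> y) \<otimes> q = (c' * d') \<odot> q"
    using q mult(1,2)[THEN gen_closed]
    by (simp_all add: m_assoc star_mult star_closed smult_mult_right)
  then show ?case
    by blast
next
  case (star x)
  then show ?case
    using gen_closed by (auto simp: star_star)
qed

text \<open>A nonzero element killed by \<open>h\<close> would act as a nonzero scalar on some
  column product \<open>q\<close>; evaluation at the permutation read off from \<open>q\<close>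
  shows that this scalar is zero.\<close>

lemma commuting_imp_inj:
  assumes dense: "norm_dense A (star_alg_gen A (entries u))"
    and comm: "\<And>i j k l. u i j \<otimes> u k l = u k l \<otimes> u i j"
  shows "inj_on h (carrier A)"
proof -
  have trivial_kernel: "x = \<zero>" if x: "x \<in> carrier A" "\<And>\<tau>. h x \<tau> = 0" for x
  proof (rule ccontr)
    assume "x \<noteq> \<zero>"
    then obtain q f where q: "q \<in> carrier A" "x \<otimes> q \<noteq> \<zero>" "\<And>j. u (f j) j \<otimes> q = q"
      and h_q: "\<And>\<tau>. (\<forall>j. Perm.apply \<tau> j = f j) \<Longrightarrow> h q \<tau> = 1"
      using ex_column_product[OF comm x(1), of UNIV] by auto
    have q0: "q \<noteq> \<zero>"
      using q(2) x(1) semiring.r_null[OF semiring_A] by metis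
    \<comment> \<open>Two columns choosing the same row would force \<open>q\<close> to vanish by
      row orthogonality.\<close>
    have "inj f"
    proof (rule injI, rule ccontr)
      fix j k assume "f j = f k" "j \<noteq> k"
      have "q = u (f j) j \<otimes> u (f k) k \<otimes> q"
        using q by (simp add: m_assoc)
      also have "\<dots> = \<zero>"
        using row_orthogonal[OF \<open>j \<noteq> k\<close>] \<open>f j = f k\<close> q(1) semiring.l_null[OF semiring_A] by simp
      finally show False
        using q0 by simp
    qed
    then have "bij f"
      by (simp add: bij_def finite_UNIV_inj_surj)
    then have \<tau>: "Perm.apply (Perm f) = f"
      by (simp add: Perm_inverse)
    then have h_q1: "h q (Perm f) = 1"
      by (simp add: h_q)
    obtain c where c: "x \<otimes> q = c \<odot> q"
      using closure_acts_as_scalar[OF dense gen_closed q(1) q0 _ x(1)]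
        gen_acts_as_scalar[OF q(1,3)] by blast
    then have "c = 0"
      using h_mult[OF x(1) q(1), of "Perm f"] h_smult[OF q(1), of c "Perm f"] x(2) h_q1 by simp
    then show False
      using c q by simp
  qed
  show ?thesis
  proof (rule inj_onI)
    fix x y assume xy: "x \<in> carrier A" "y \<in> carrier A" "h x = h y"
    then have "x \<oplus> (- 1) \<odot> y = \<zero>"
      by (intro trivial_kernel) (simp_all add: h_add h_smult)
    then have "x \<oplus> ((- 1) \<odot> y \<oplus> y) = \<zero> \<oplus> y"
      using xy by (simp add: a_assoc[symmetric])
    then show "x = y"
      using xy l_neg[OF xy(2)] by (simp add: a_inv_eq_smult)
  qed
qed

end

section \<open>Symmetry under the classical permutations\<close>

lemma finsum_mult_finsum:
  assumes "semiring R" and "finite I" "finite J"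
    and "f \<in> I \<rightarrow> carrier R" "g \<in> J \<rightarrow> carrier R"
  shows "(\<Oplus>\<^bsub>R\<^esub>i\<in>I. f i) \<otimes>\<^bsub>R\<^esub> (\<Oplus>\<^bsub>R\<^esub>j\<in>J. g j) =
    (\<Oplus>\<^bsub>R\<^esub>p\<in>I \<times> J. f (fst p) \<otimes>\<^bsub>R\<^esub> g (snd p))"
proof -
  interpret semiring R by fact
  have g: "(\<Oplus>\<^bsub>R\<^esub>j\<in>J. g j) \<in> carrier R"
    using assms(5) by (rule finsum_closed)
  show ?thesis
    using assms(2,4)
  proof (induction I)
    case empty
    then show ?case
      using g by simp
  next
    case (insert i I)
    have fi: "f i \<in> carrier R" and fI: "f \<in> I \<rightarrow> carrier R"
      using insert.prems by auto
    have "(\<Oplus>\<^bsub>R\<^esub>p\<in>insert i I \<times> J. f (fst p) \<otimes>\<^bsub>R\<^esub> g (snd p)) =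
        (\<Oplus>\<^bsub>R\<^esub>p\<in>(\<lambda>j. (i, j)) ` J \<union> I \<times> J. f (fst p) \<otimes>\<^bsub>R\<^esub> g (snd p))"
      by (rule arg_cong[where f = "finsum R _"]) auto
    also have "\<dots> = (\<Oplus>\<^bsub>R\<^esub>p\<in>(\<lambda>j. (i, j)) ` J. f (fst p) \<otimes>\<^bsub>R\<^esub> g (snd p)) \<oplus>\<^bsub>R\<^esub>
        (\<Oplus>\<^bsub>R\<^esub>p\<in>I \<times> J. f (fst p) \<otimes>\<^bsub>R\<^esub> g (snd p))"
      by (rule finsum_Un_disjoint) (use insert assms fi fI in \<open>auto simp: Pi_iff\<close>)
    also have "(\<Oplus>\<^bsub>R\<^esub>p\<in>(\<lambda>j. (i, j)) ` J. f (fst p) \<otimes>\<^bsub>R\<^esub> g (snd p)) = (\<Oplus>\<^bsub>R\<^esub>j\<in>J. f i \<otimes>\<^bsub>R\<^esub> g j)"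
      by (subst finsum_reindex) (use fi assms(5) in \<open>auto simp: inj_on_def Pi_iff\<close>)
    also have "\<dots> = f i \<otimes>\<^bsub>R\<^esub> (\<Oplus>\<^bsub>R\<^esub>j\<in>J. g j)"
      using finsum_rdistr[OF assms(3) fi assms(5)] by simp
    also have "\<dots> \<oplus>\<^bsub>R\<^esub> (\<Oplus>\<^bsub>R\<^esub>p\<in>I \<times> J. f (fst p) \<otimes>\<^bsub>R\<^esub> g (snd p)) =
        (\<Oplus>\<^bsub>R\<^esub>i\<in>insert i I. f i) \<otimes>\<^bsub>R\<^esub> (\<Oplus>\<^bsub>R\<^esub>j\<in>J. g j)"
      using insert.IH[OF fI] insert.hyps fi fI g by (simp add: l_distr)
    finally show ?case
      by simp
  qed
qed

text \<open>The three sums are multiplied one after the other, so the summation index has the shape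
  \<open>((k, l), m)\<close>.\<close>

lemma comult_triple:
  assumes "magic A u" "min_tensor_product A A T t" "star_hom A T \<Delta>"
    and \<Delta>: "\<And>i j. \<Delta> (u i j) = (\<Oplus>\<^bsub>T\<^esub>k\<in>UNIV. t (u i k) (u k j))"
  shows "\<Delta> (u a b \<otimes>\<^bsub>A\<^esub> u c d \<otimes>\<^bsub>A\<^esub> u e f) =
    (\<Oplus>\<^bsub>T\<^esub>p\<in>UNIV. t (u a (fst (fst p)) \<otimes>\<^bsub>A\<^esub> u c (snd (fst p)) \<otimes>\<^bsub>A\<^esub> u e (snd p))
                (u (fst (fst p)) b \<otimes>\<^bsub>A\<^esub> u (snd (fst p)) d \<otimes>\<^bsub>A\<^esub> u (snd p) f))"
proof -
  interpret magic A u by fact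
  interpret T: min_tensor_product A A T t by fact
  have T: "semiring T"
    by (rule T.T.semiring_A)
  have closed: "t (u i k) (u l j) \<in> carrier T" for i j k l
    by (simp add: T.tensor_closed)
  have mult: "\<Delta> (x \<otimes>\<^bsub>A\<^esub> y) = \<Delta> x \<otimes>\<^bsub>T\<^esub> \<Delta> y" if "x \<in> carrier A" "y \<in> carrier A" for x y
    using assms(3) that by (auto simp: star_hom_def ring_hom_def)
  have "\<Delta> (u a b) \<otimes>\<^bsub>T\<^esub> \<Delta> (u c d) =
      (\<Oplus>\<^bsub>T\<^esub>p\<in>UNIV. t (u a (fst p)) (u (fst p) b) \<otimes>\<^bsub>T\<^esub> t (u c (snd p)) (u (snd p) d))"
    unfolding \<Delta> using closed by (subst finsum_mult_finsum[OF T]) auto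
  also have "\<dots> = (\<Oplus>\<^bsub>T\<^esub>p\<in>UNIV. t (u a (fst p) \<otimes>\<^bsub>A\<^esub> u c (snd p)) (u (fst p) b \<otimes>\<^bsub>A\<^esub> u (snd p) d))"
    by (simp add: T.tensor_mult)
  finally have "\<Delta> (u a b) \<otimes>\<^bsub>T\<^esub> \<Delta> (u c d) \<otimes>\<^bsub>T\<^esub> \<Delta> (u e f) = \<dots> \<otimes>\<^bsub>T\<^esub> (\<Oplus>\<^bsub>T\<^esub>k\<in>UNIV. t (u e k) (u k f))"
    unfolding \<Delta>[of e] by simp
  also have "\<dots> = (\<Oplus>\<^bsub>T\<^esub>p\<in>UNIV. t (u a (fst (fst p)) \<otimes>\<^bsub>A\<^esub> u c (snd (fst p)))
        (u (fst (fst p)) b \<otimes>\<^bsub>A\<^esub> u (snd (fst p)) d) \<otimes>\<^bsub>T\<^esub> t (u e (snd p)) (u (snd p) f))"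
    by (subst finsum_mult_finsum[OF T]) (auto simp: T.tensor_closed)
  finally show ?thesis
    by (simp add: mult T.tensor_mult)
qed

locale quantum_symmetry = classical_point A u h
  for A :: "'a cstar" (structure) and u :: "'n::finite \<Rightarrow> 'n \<Rightarrow> 'a" and h +
  fixes T :: "'t cstar" and t \<Delta>
  assumes tensor: "min_tensor_product A A T t"
    and comult: "star_hom A T \<Delta>" "\<And>i j. \<Delta> (u i j) = (\<Oplus>\<^bsub>T\<^esub>k\<in>UNIV. t (u i k) (u k j))"
begin

text \<open>\<open>\<Delta>\<close> maps the monomial to zero, and its expansion lies in the
  algebraic tensor product, where any bilinear map may take the place of \<open>t\<close>. This
  yields slices with values in \<open>A\<close> directly from the algebraic sum.\<close>

lemma bilinear_triple:
  assumes zero: "u a b \<otimes> u c d \<otimes> u e f = \<zero>" and \<beta>: "complex_bilinear A A A \<beta>"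
  shows "(\<Oplus>p\<in>UNIV. \<beta> (u a (fst (fst p)) \<otimes> u c (snd (fst p)) \<otimes> u e (snd p))
    (u (fst (fst p)) b \<otimes> u (snd (fst p)) d \<otimes> u (snd p) f)) = \<zero>"
proof (rule min_tensor_product.bilinear_sum_eq_zero[OF tensor \<beta>])
  interpret T: min_tensor_product A A T t by (rule tensor)
  have "\<Delta> \<zero> = \<Delta> (0 \<odot> \<zero>)"
    by simp
  also have "\<dots> = 0 \<odot>\<^bsub>T\<^esub> \<Delta> \<zero>"
    using comult(1) semiring.semiring_simprules(2)[OF semiring_A] unfolding star_hom_def by blast
  also have "\<dots> = \<zero>\<^bsub>T\<^esub>"
    using comult(1) by (intro T.T.smult_0) (auto simp: star_hom_def ring_hom_def)
  finally show "(\<Oplus>\<^bsub>T\<^esub>p\<in>UNIV. t (u a (fst (fst p)) \<otimes> u c (snd (fst p)) \<otimes> u e (snd p))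
    (u (fst (fst p)) b \<otimes> u (snd (fst p)) d \<otimes> u (snd p) f)) = \<zero>\<^bsub>T\<^esub>"
    using comult_triple[OF magic_axioms tensor comult, of a b c d e f] zero by simp
qed auto

text \<open>Evaluating the second leg at \<open>\<tau>\<close> turns \<open>\<Delta> (u a b)\<close>
  into \<open>u a (\<tau> b)\<close>: the value of \<open>u k b\<close> at \<open>\<tau>\<close> is
  one for \<open>k = \<tau> b\<close> and zero otherwise, so only the summand \<open>?p\<close>
  survives.\<close>

lemma permute_columns:
  assumes "u a b \<otimes> u c d \<otimes> u e f = \<zero>"
  shows "u a (Perm.apply \<tau> b) \<otimes> u c (Perm.apply \<tau> d) \<otimes> u e (Perm.apply \<tau> f) = \<zero>"
proof -
  let ?p = "((Perm.apply \<tau> b, Perm.apply \<tau> d), Perm.apply \<tau> f)"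
  let ?g = "\<lambda>p. h (u (fst (fst p)) b \<otimes> u (snd (fst p)) d \<otimes> u (snd p) f) \<tau> \<odot>
    (u a (fst (fst p)) \<otimes> u c (snd (fst p)) \<otimes> u e (snd p))"
  have "complex_bilinear A A A (\<lambda>x y. h y \<tau> \<odot> x)"
    by unfold_locales
      (simp_all add: smult_add_right smult_add_left h_add h_smult mult.commute)
  from bilinear_triple[OF assms this] have "(\<Oplus>p\<in>UNIV. ?g p) = \<zero>"
    by simp
  moreover have "(\<Oplus>p\<in>UNIV. ?g p) = ?g ?p"
    by (rule finsum_single) (auto simp: h_mult h_entry)
  ultimately show ?thesis
    by (simp add: h_mult h_entry)
qed

text \<open>Evaluating the first leg at \<open>\<tau>\<close> sends
  \<open>\<Delta> (u (\<tau> a) b)\<close> to \<open>u a b\<close>, by injectivity of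
  \<open>\<tau>\<close>. The permutation therefore appears in the hypothesis here, not in the
  conclusion.\<close>

lemma permute_rows:
  assumes "u (Perm.apply \<tau> a) b \<otimes> u (Perm.apply \<tau> c) d \<otimes> u (Perm.apply \<tau> e) f = \<zero>"
  shows "u a b \<otimes> u c d \<otimes> u e f = \<zero>"
proof -
  let ?p = "((a, c), e)"
  let ?g = "\<lambda>p. h (u (Perm.apply \<tau> a) (fst (fst p)) \<otimes> u (Perm.apply \<tau> c) (snd (fst p)) \<otimes>
      u (Perm.apply \<tau> e) (snd p)) \<tau> \<odot> (u (fst (fst p)) b \<otimes> u (snd (fst p)) d \<otimes> u (snd p) f)"
  have "complex_bilinear A A A (\<lambda>x y. h x \<tau> \<odot> y)"
    by unfold_locales
      (simp_all add: smult_add_right smult_add_left h_add h_smult mult.commute)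
  from bilinear_triple[OF assms this] have "(\<Oplus>p\<in>UNIV. ?g p) = \<zero>"
    by simp
  moreover have "(\<Oplus>p\<in>UNIV. ?g p) = ?g ?p"
    by (rule finsum_single) (auto simp: h_mult h_entry apply_inj)
  ultimately show ?thesis
    by (simp add: h_mult h_entry)
qed

end

section \<open>Permutations with prescribed values\<close>

lemma ex_perm_extending:
  fixes g :: "'n::finite \<Rightarrow> 'n"
  assumes "inj_on g S"
  obtains \<tau> where "\<And>x. x \<in> S \<Longrightarrow> Perm.apply \<tau> x = g x"
proof -
  \<comment> \<open>The complements of \<open>S\<close> and of its image have equal size, so a
    bijection between them completes \<open>g\<close>.\<close>
  have "card (- S) = card (- (g ` S))"
    using assms by (simp add: Compl_eq_Diff_UNIV card_Diff_subset card_image)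
  then obtain k where k: "bij_betw k (- S) (- (g ` S))"
    using finite_same_card_bij[of "- S" "- (g ` S)"] by auto
  define f where "f x = (if x \<in> S then g x else k x)" for x
  have "bij_betw f S (g ` S)"
    using assms by (simp add: f_def bij_betw_def inj_on_def image_def)
  moreover have "bij_betw f (- S) (- (g ` S))"
    using k by (subst bij_betw_cong[where g = k]) (auto simp: f_def)
  ultimately have "bij_betw f (S \<union> - S) (g ` S \<union> - (g ` S))"
    by (rule bij_betw_combine) auto
  then have "bij f"
    by (simp add: Compl_partition)
  then show ?thesis
    using that[of "Perm f"] by (simp add: Perm_inverse f_def)
qed

text \<open>Equal patterns of coincidences make the assignment \<open>b\<close> to \<open>a\<close>,
  \<open>d\<close> to \<open>c\<close>, \<open>f\<close> to \<open>e\<close> well defined and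
  injective.\<close>

lemma ex_perm_triple:
  fixes a b c d e f :: "'n::finite"
  assumes "a = c \<longleftrightarrow> b = d" "c = e \<longleftrightarrow> d = f" "a = e \<longleftrightarrow> b = f"
  obtains \<tau> where "Perm.apply \<tau> b = a" "Perm.apply \<tau> d = c" "Perm.apply \<tau> f = e"
proof -
  define g where "g x = (if x = b then a else if x = d then c else e)" for x
  have "inj_on g {b, d, f}"
    using assms by (auto simp: inj_on_def g_def)
  then obtain \<tau> where \<tau>: "\<And>x. x \<in> {b, d, f} \<Longrightarrow> Perm.apply \<tau> x = g x"
    using ex_perm_extending by metis
  show ?thesis
    by (rule that[of \<tau>]) (use \<tau> assms in \<open>auto simp: g_def\<close>)
qed

section \<open>Commutation forced by a vanishing monomial\<close>

context quantum_symmetry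
begin

text \<open>
  Both cases are the same computation: by symmetry every summand of \<open>u a b u c d = \<Sum>k u a b u c d u a k\<close>
  (respectively \<open>\<Sum>k u a b u c d u k b\<close>) other than \<open>u a b u c d u a b\<close> vanishes.
\<close>

lemma commute_if_row_triple_zero:
  assumes zero: "u i j \<otimes> u k l \<otimes> u i m = \<zero>" and dist: "i \<noteq> k" "j \<noteq> l" "l \<noteq> m" "j \<noteq> m"
    and ac: "a \<noteq> c" and bd: "b \<noteq> d"
  shows "u a b \<otimes> u c d = u c d \<otimes> u a b"
proof -
  have vanish: "u a b \<otimes> u c d \<otimes> u a f = \<zero>" if f: "f \<noteq> b" for f
  proof (cases "f = d")
    \<comment> \<open>The last two factors lie in the same column and in different rows, so their
      product is already zero.\<close>
    case True
    then show ?thesis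
      using ac semiring.r_null[OF semiring_A] col_orthogonal[of c a d]
      by (simp add: m_assoc)
  next
    case False
    obtain \<tau> where \<tau>: "Perm.apply \<tau> j = b" "Perm.apply \<tau> l = d" "Perm.apply \<tau> m = f"
      using ex_perm_triple[of b d j l f m] dist bd f False by metis
    \<comment> \<open>\<open>permute_rows\<close> transports zeros backwards, so
      \<open>\<rho>\<close> sends the wanted rows to the given ones; the repeated row enters as the
      third coordinate.\<close>
    obtain \<rho> where \<rho>: "Perm.apply \<rho> a = i" "Perm.apply \<rho> c = k" "Perm.apply \<rho> a = i"
      using ex_perm_triple[of i k a c i a] dist ac by metis
    show ?thesis
      using permute_rows[of \<rho> a b c d a f] permute_columns[OF zero, of \<tau>] \<tau> \<rho> by simp
  qed
  let ?g = "\<lambda>f. u a b \<otimes> u c d \<otimes> u a f"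
  have "?g b = (\<Oplus>f\<in>UNIV. ?g f)"
    by (rule finsum_single[symmetric]) (use vanish in auto)
  also have "\<dots> = u a b \<otimes> u c d"
    by (rule mult_row_sum) simp
  finally show ?thesis
    by (rule commute_if_absorbed)
qed

lemma commute_if_column_triple_zero:
  assumes zero: "u i j \<otimes> u k l \<otimes> u m j = \<zero>" and dist: "i \<noteq> k" "j \<noteq> l" "k \<noteq> m" "i \<noteq> m"
    and ac: "a \<noteq> c" and bd: "b \<noteq> d"
  shows "u a b \<otimes> u c d = u c d \<otimes> u a b"
proof -
  have vanish: "u a b \<otimes> u c d \<otimes> u e b = \<zero>" if e: "e \<noteq> a" for e
  proof (cases "e = c")
    case True
    then show ?thesis
      using bd semiring.r_null[OF semiring_A] row_orthogonal[of d b c]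
      by (simp add: m_assoc)
  next
    case False
    \<comment> \<open>Now the column is repeated and the three rows are distinct.\<close>
    obtain \<tau> where \<tau>: "Perm.apply \<tau> j = b" "Perm.apply \<tau> l = d" "Perm.apply \<tau> j = b"
      using ex_perm_triple[of b d j l b j] dist bd by metis
    obtain \<rho> where \<rho>: "Perm.apply \<rho> a = i" "Perm.apply \<rho> c = k" "Perm.apply \<rho> e = m"
      using ex_perm_triple[of i k a c m e] dist ac e False by metis
    show ?thesis
      using permute_rows[of \<rho> a b c d e b] permute_columns[OF zero, of \<tau>] \<tau> \<rho> by simp
  qed
  let ?g = "\<lambda>e. u a b \<otimes> u c d \<otimes> u e b"
  have "?g a = (\<Oplus>e\<in>UNIV. ?g e)"
    by (rule finsum_single[symmetric]) (use vanish in auto)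
  also have "\<dots> = u a b \<otimes> u c d"
    by (rule mult_col_sum) simp
  finally show ?thesis
    by (rule commute_if_absorbed)
qed

text \<open>If both adjacent patterns match, the outer one decides. When it matches too, some
  permutation gives the monomial the value one; otherwise all entries commute, which contradicts
  that \<open>h\<close> is not injective.\<close>

lemma triple_zero_imp:
  assumes dense: "norm_dense A (star_alg_gen A (entries u))"
    and not_inj: "\<not> inj_on h (carrier A)"
    and zero: "u a b \<otimes> u c d \<otimes> u e f = \<zero>"
  shows "((a = c) \<noteq> (b = d)) \<or> ((c = e) \<noteq> (d = f))"
proof (rule ccontr)
  assume "\<not> ?thesis"
  then have pattern: "a = c \<longleftrightarrow> b = d" "c = e \<longleftrightarrow> d = f"
    by auto
  have "\<not> (a = e \<longleftrightarrow> b = f)"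
  proof
    assume "a = e \<longleftrightarrow> b = f"
    then obtain \<tau> where "Perm.apply \<tau> b = a" "Perm.apply \<tau> d = c" "Perm.apply \<tau> f = e"
      using ex_perm_triple pattern by metis
    then have "h (u a b \<otimes> u c d \<otimes> u e f) \<tau> = 1"
      by (simp add: h_mult h_entry)
    then show False
      using zero h_zero by simp
  qed
  \<comment> \<open>Exactly one of \<open>a = e\<close>, \<open>b = f\<close> holds, and with
    \<open>pattern\<close> this makes both adjacent pairs differ in rows and in columns. The two
    possibilities are the row and the column version of the commutation lemma.\<close>
  then have comm: "i \<noteq> k \<Longrightarrow> j \<noteq> l \<Longrightarrow> u i j \<otimes> u k l = u k l \<otimes> u i j" for i j k l
    using commute_if_row_triple_zero[of a b c d f i k j l]
      commute_if_column_triple_zero[of a b c d e i k j l] zero pattern by metis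
  \<comment> \<open>Distinct entries sharing a row or a column commute because both products are
    zero.\<close>
  then have "u i j \<otimes> u k l = u k l \<otimes> u i j" for i j k l
    by (cases "i = k"; cases "j = l") (auto simp: row_orthogonal col_orthogonal intro: comm)
  then show False
    using commuting_imp_inj[OF dense] not_inj by blast
qed

end

theorem theorem3p3:
  fixes A :: "'a cstar" and u :: "'n::finite \<Rightarrow> 'n \<Rightarrow> 'a"
    and T :: "'t cstar" and t :: "'a \<Rightarrow> 'a \<Rightarrow> 't" and \<Delta> :: "'a \<Rightarrow> 't"
    and P :: "'p cstar" and v :: "'n \<Rightarrow> 'n \<Rightarrow> 'p"
  assumes "quantum_permutation_group A u T t \<Delta>"
    and "universal_magic_algebra P v"
    and "exotic A u P v"
  shows "free_orbitals A u 3 \<and>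
    (\<forall>a b c d e f. u a b \<otimes>\<^bsub>A\<^esub> u c d \<otimes>\<^bsub>A\<^esub> u e f = \<zero>\<^bsub>A\<^esub> \<longrightarrow>
       ((a = c) \<noteq> (b = d)) \<or> ((c = e) \<noteq> (d = f)))"
proof -
  obtain h where h: "quotient_map sym_alg sym_magic A u h"
    and not_bij: "\<not> bij_betw h (carrier A) (carrier sym_alg)"
    using assms(3) by (auto simp: exotic_def strict_quantum_subgroup_def)
  \<comment> \<open>\<open>h\<close> is surjective as a quotient map, so strictness of the inclusion
    means that it fails to be injective.\<close>
  have h_hom: "star_hom A sym_alg h" "\<And>i j. h (u i j) = sym_magic i j"
    and not_inj: "\<not> inj_on h (carrier A)"
    using h not_bij unfolding quotient_map_def bij_betw_def by blast+
  have gen: "cstar_algebra A" "magic_unitary A u" "norm_dense A (star_alg_gen A (entries u))"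
    and comult: "min_tensor_product A A T t" "star_hom A T \<Delta>"
      "\<And>i j. \<Delta> (u i j) = (\<Oplus>\<^bsub>T\<^esub>k\<in>UNIV. t (u i k) (u k j))"
    using assms(1) unfolding quantum_permutation_group_def generated_by_magic_def by blast+
  interpret quantum_symmetry A u h T t \<Delta>
    by (intro quantum_symmetry.intro classical_point.intro magic.intro magic_axioms.intro
        classical_point_axioms.intro quantum_symmetry_axioms.intro gen h_hom comult)
  note triple = triple_zero_imp[OF gen(3) not_inj]
  have "free_orbitals A u 3"
    unfolding free_orbitals_def
  proof (intro allI impI)
    fix i j :: "nat \<Rightarrow> 'n"
    assume "foldr (\<lambda>k x. u (i k) (j k) \<otimes>\<^bsub>A\<^esub> x) [1..<Suc 3] \<one>\<^bsub>A\<^esub> = \<zero>\<^bsub>A\<^esub>"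
    moreover have "[1..<Suc 3] = [1, 2, 3]"
      by (simp add: upt_rec)
    \<comment> \<open>The fold is nested to the right and ends in the unit; associativity gives the
      left-nested product.\<close>
    ultimately have "u (i 1) (j 1) \<otimes>\<^bsub>A\<^esub> u (i 2) (j 2) \<otimes>\<^bsub>A\<^esub> u (i 3) (j 3) = \<zero>\<^bsub>A\<^esub>"
      by (simp add: m_assoc)
    then have "(i 1 = i 2) \<noteq> (j 1 = j 2) \<or> (i 2 = i 3) \<noteq> (j 2 = j 3)"
      by (rule triple)
    then show "\<exists>n\<in>{1..<3}. (i n = i (Suc n)) \<noteq> (j n = j (Suc n))"
    proof
      assume "(i 1 = i 2) \<noteq> (j 1 = j 2)"
      then show ?thesis
        by (intro bexI[of _ 1]) (simp_all add: numeral_2_eq_2)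
    next
      assume "(i 2 = i 3) \<noteq> (j 2 = j 3)"
      then show ?thesis
        by (intro bexI[of _ 2]) simp_all
    qed
  qed
  then show ?thesis
    using triple by blast
qed

end
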